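(* Let $G$ be a large group. For any prime $p$ and any $N > 0$, there exist infinitely many geodesics $\gamma$, each in a different connected component of $\Gamma_p(G)$, such that the length of each $\gamma$ is greater than $N$.
   Context: A group is large if it contains a finite-index subgroup that admits a surjective homomorphism onto a non-cyclic free group. For a group $G$ and a prime $p$, the $p$-local commensurability graph $\Gamma_p(G)$ is the simple graph whose vertices are the finite-index subgroups of $G$, where two distinct vertices $A, B \leq G$ are adjacent if and only if $[A : A\cap B][B : A\cap B]$ is a power of $p$. The length of a path is its number of edges, the distance between two vertices of a component is the least length of a path joining them, and a geodesic is a path whose length equals the distance between its endpoints. *)

theory Defs
  imports
    "HOL-Algebra.Elementary_Groups"
    "HOL-Algebra.Weak_Morphisms"
    "HOL-Computational_Algebra.Primes"
    "Graph_Theory.Digraph_Component"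
begin

section \<open>Free groups and large groups\<close>

text \<open>A letter \<open>(x, True)\<close> stands for \<open>x\<close>, a letter \<open>(x, False)\<close> for the formal inverse of \<open>x\<close>.\<close>

definition letter_val :: "('a, 'b) monoid_scheme \<Rightarrow> 'a \<times> bool \<Rightarrow> 'a" where
  "letter_val F l = (if snd l then fst l else inv\<^bsub>F\<^esub> (fst l))"

definition word_val :: "('a, 'b) monoid_scheme \<Rightarrow> ('a \<times> bool) list \<Rightarrow> 'a" where
  "word_val F w = foldr (\<lambda>l x. letter_val F l \<otimes>\<^bsub>F\<^esub> x) w \<one>\<^bsub>F\<^esub>"

definition reduced_word :: "('a \<times> bool) list \<Rightarrow> bool" where
  "reduced_word = successively (\<lambda>l m. \<not> (fst l = fst m \<and> snd l \<noteq> snd m))"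

definition free_basis :: "('a, 'b) monoid_scheme \<Rightarrow> 'a set \<Rightarrow> bool" where
  "free_basis F S \<longleftrightarrow> S \<subseteq> carrier F \<and>
     bij_betw (word_val F) {w \<in> lists (S \<times> UNIV). reduced_word w} (carrier F)"

definition free_group :: "('a, 'b) monoid_scheme \<Rightarrow> bool" where
  "free_group F \<longleftrightarrow> group F \<and> (\<exists>S. free_basis F S)"

definition finite_index :: "('a, 'b) monoid_scheme \<Rightarrow> 'a set \<Rightarrow> bool" where
  "finite_index G H \<longleftrightarrow> subgroup H G \<and> finite (rcosets\<^bsub>G\<^esub> H)"

text \<open>
  The free group \<open>F\<close> ranges over groups on the type of elements of \<open>G\<close>.  This is no restriction:
  a homomorphic image of a subgroup of \<open>G\<close> can be carried by a set of representatives in \<open>G\<close>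
  (lemma \<open>large_groupI\<close> below).
\<close>

definition large_group :: "('a, 'b) monoid_scheme \<Rightarrow> bool" where
  "large_group G \<longleftrightarrow> group G \<and>
     (\<exists>H (F :: 'a monoid) h. finite_index G H \<and> free_group F \<and> \<not> cyclic_group F \<and>
        h \<in> epi (G\<lparr>carrier := H\<rparr>) F)"

lemma large_groupI:
  fixes F :: "('c, 'd) monoid_scheme"
  assumes "group G" "finite_index G H" "free_group F" "\<not> cyclic_group F"
    and h: "h \<in> epi (G\<lparr>carrier := H\<rparr>) F"
  shows "large_group G"
proof -
  interpret F: group F using assms(3) by (simp add: free_group_def)
  define g where "g = inv_into H h"
  have hH: "h ` H = carrier F" and hhom: "h \<in> hom (G\<lparr>carrier := H\<rparr>) F"
    using h by (auto simp: epi_def)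
  have g: "g x \<in> H" "h (g x) = x" if "x \<in> carrier F" for x
    using that hH by (auto simp: g_def inv_into_into f_inv_into_f)
  have inj: "inj_on g (carrier F)" by (metis g(2) inj_onI)
  define F' where "F' = image_group g F"
  have iso: "g \<in> iso F F'" unfolding F'_def using inj_imp_image_group_iso[OF inj] .
  interpret F': group F' unfolding F'_def by (rule F.inj_imp_image_group_is_group[OF inj])
  interpret gh: group_hom F F' g
    using iso by (simp add: group_hom_def group_hom_axioms_def iso_def)
  have bg: "bij_betw g (carrier F) (carrier F')" using iso by (simp add: iso_def)
  have "\<not> cyclic_group F'"
    using isomorphic_group_cyclicity[OF is_isoI[OF iso]] assms(4) F.group_axioms F'.group_axioms
    by blast
  moreover have "free_group F'"
  proof -
    obtain S where S: "S \<subseteq> carrier F"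
      and bS: "bij_betw (word_val F) {w \<in> lists (S \<times> UNIV). reduced_word w} (carrier F)"
      using assms(3) by (auto simp: free_group_def free_basis_def)
    let ?m = "map (map_prod g id) :: ('c \<times> bool) list \<Rightarrow> _"
    let ?W = "{w \<in> lists (S \<times> UNIV). reduced_word w}"
    let ?W' = "{w \<in> lists (g ` S \<times> UNIV). reduced_word w}"
    have injS: "inj_on g S" using inj S by (rule inj_on_subset)
    have red: "reduced_word (?m w) = reduced_word w" if "w \<in> lists (S \<times> UNIV)" for w
    proof -
      have "(g (fst l) = g (fst m)) = (fst l = fst m)" if "l \<in> set w" "m \<in> set w" for l m
      proof -
        have "fst l \<in> S" "fst m \<in> S" using \<open>w \<in> _\<close> that by auto
        then show ?thesis using injS by (simp add: inj_on_eq_iff)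
      qed
      then show ?thesis
        unfolding reduced_word_def successively_map by (intro successively_cong) auto
    qed
    have lists': "lists (g ` S \<times> UNIV) = ?m ` lists (S \<times> UNIV)"
    proof -
      have "map_prod g id ` (S \<times> (UNIV :: bool set)) = g ` S \<times> UNIV" by force
      then show ?thesis by (metis lists_image)
    qed
    have W': "?W' = ?m ` ?W"
      unfolding lists' using red by auto
    have injm: "inj_on ?m ?W"
    proof -
      have "inj_on (map_prod g id) (S \<times> (UNIV :: bool set))"
        using map_prod_inj_on[OF injS, of id UNIV] by simp
      then have "inj_on ?m (lists (S \<times> UNIV))" by (rule inj_on_map_lists)
      then show ?thesis by (rule inj_on_subset) blast
    qed
    have val: "word_val F w \<in> carrier F \<and> word_val F' (?m w) = g (word_val F w)"
      if "w \<in> lists (S \<times> UNIV)" for w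
      using that
    proof (induction w)
      case Nil
      then show ?case by (simp add: word_val_def)
    next
      case (Cons l w)
      then have l: "fst l \<in> carrier F" using S by auto
      then have "letter_val F l \<in> carrier F"
        "letter_val F' (map_prod g id l) = g (letter_val F l)"
        by (auto simp: letter_val_def)
      with Cons show ?case by (simp add: word_val_def id_def)
    qed
    have "bij_betw ?m ?W ?W'" using injm W' by (simp add: bij_betw_def)
    moreover have "bij_betw (word_val F' \<circ> ?m) ?W (carrier F')"
      using bij_betw_trans[OF bS bg] val by (subst bij_betw_cong[where g = "g \<circ> word_val F"]) auto
    ultimately have "bij_betw (word_val F') ?W' (carrier F')"
      using bij_betw_comp_iff by blast
    then have "free_basis F' (g ` S)" using S by (auto simp: free_basis_def)
    then show ?thesis using F'.group_axioms by (auto simp: free_group_def)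
  qed
  moreover have "g \<circ> h \<in> epi (G\<lparr>carrier := H\<rparr>) F'"
  proof -
    have "g \<circ> h \<in> hom (G\<lparr>carrier := H\<rparr>) F'"
      using hom_compose[OF hhom gh.homh] .
    moreover have "(g \<circ> h) ` H = carrier F'"
      using hH bg by (metis bij_betw_def image_comp)
    ultimately show ?thesis by (simp add: epi_def)
  qed
  ultimately show ?thesis using assms(1,2) unfolding large_group_def by blast
qed


section \<open>The local commensurability graph\<close>

definition index_in :: "('a, 'b) monoid_scheme \<Rightarrow> 'a set \<Rightarrow> 'a set \<Rightarrow> nat" where
  "index_in G A C = card (rcosets\<^bsub>G\<lparr>carrier := A\<rparr>\<^esub> C)"

text \<open>A simple graph is represented by the symmetric loop-free digraph with both orientations of
  every edge, so \<open>pre_digraph.scc_of D A\<close> is the connected component of the vertex \<open>A\<close>.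
  \<^const>\<open>card\<close> gives \<open>0\<close> on infinite sets, but all indices below are finite.\<close>

definition local_commens_graph ::
    "('a, 'b) monoid_scheme \<Rightarrow> nat \<Rightarrow> 'a set pair_pre_digraph" where
  "local_commens_graph G p =
     \<lparr>pverts = {A. finite_index G A},
      parcs = {(A, B). finite_index G A \<and> finite_index G B \<and> A \<noteq> B \<and>
        (\<exists>k. index_in G A (A \<inter> B) * index_in G B (A \<inter> B) = p ^ k)}\<rparr>"

lemma pair_bidirected_digraph_local_commens_graph:
  "pair_bidirected_digraph (local_commens_graph G p)"
  by unfold_locales
    (auto simp: local_commens_graph_def symmetric_def sym_def Int_commute mult.commute)

text \<open>Only meaningful for \<open>u\<close>, \<open>v\<close> in one component, which holds where it is used.\<close>

definition graph_distance :: "('a, 'b) pre_digraph \<Rightarrow> 'a \<Rightarrow> 'a \<Rightarrow> nat" where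
  "graph_distance D u v = (LEAST n. \<exists>q. pre_digraph.apath D u q v \<and> length q = n)"

definition geodesic :: "('a, 'b) pre_digraph \<Rightarrow> 'a \<Rightarrow> 'b list \<Rightarrow> 'a \<Rightarrow> bool" where
  "geodesic D u q v \<longleftrightarrow> pre_digraph.apath D u q v \<and> length q = graph_distance D u v"

end

theory Submission
  imports Defs "HOL-Algebra.Sym_Groups"
begin

text \<open>
  Let \<open>H\<close> be the finite-index subgroup that maps onto a free group, let \<open>q = p ^ k\<close> be large and
  \<open>n = q + c\<close>.  A non-cyclic free group maps onto the symmetric group on \<open>n\<close> points, so \<open>H\<close> does.
  Let \<open>N\<close> be the normal core of \<open>H\<close>, and \<open>\<rho>\<close> the resulting action of \<open>N\<close> on \<open>{1..n}\<close>.  The index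
  of \<open>N\<close> is fixed while \<open>n\<close> grows, so the image of \<open>N\<close> still contains all \<open>3\<close>-cycles
  (\<open>three_cycles_in_image_of_normal\<close>).

  For \<open>S \<subseteq> {1..n}\<close> let \<open>supported S\<close> be the elements of \<open>N\<close> that fix every point outside \<open>S\<close>.
  If \<open>card S = q\<close> and \<open>x \<in> S\<close>, then \<open>supported S\<close> acts transitively on \<open>S\<close> and
  \<open>supported (S - {x})\<close> is a point stabilizer, of index \<open>q = p ^ k\<close>.  So the two are adjacent, and
  one can walk from \<open>supported S\<close> to \<open>supported T\<close> for any two \<open>q\<close>-sets of points by exchanging one
  point at a time.  The claim is that nothing is essentially faster: a path from \<open>supported S\<close> to
  \<open>supported T\<close> has length at least \<open>card (S - T)\<close>, which can be made equal to \<open>c\<close>.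

  For the lower bound, replace every vertex \<open>B\<close> on a path by the permutation group
  \<open>trace B = \<rho> ` (B \<inter> N)\<close>.  As \<open>N\<close> is normal, an edge still yields a common subgroup of \<open>p\<close>-power
  index (\<open>card_trace\<close>); intersecting with \<open>H\<close> itself could bring in other primes.  Along the path every trace has
  exactly one orbit of length \<open>q - 1\<close> or \<open>q\<close>, and the two orbits belonging to an edge differ in at
  most one point (\<open>good_step\<close>).  There are two directions.

  Passing from a group to an overgroup in which it has index a power of \<open>p\<close>, the new orbit length
  divides a power of \<open>p\<close> times the old one and lies between \<open>q - 1\<close> and \<open>q + c\<close>; as \<open>c\<close> is small
  compared with \<open>q\<close>, only \<open>q - 1\<close> and \<open>q\<close> are possible (\<open>big_orbit_supergroup\<close>).

  Passing to a subgroup of \<open>p\<close>-power index, an orbit of length \<open>q - 1\<close> survives because \<open>q - 1\<close> is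
  coprime to \<open>p\<close>.  An orbit of length \<open>q\<close> might split.  But the order of the group is, up to
  powers of \<open>p\<close>, a multiple of \<open>q!/2\<close>, and a splitting into parts of sizes \<open>e\<close> and \<open>q - e\<close> with
  \<open>2 \<le> e \<le> q - 2\<close> would make \<open>q choose e\<close> divide \<open>2 c!\<close> times a power of \<open>p\<close>.  The \<open>p\<close>-part of
  \<open>q choose e\<close> is at most \<open>q\<close>, so \<open>(q - 1) / 2 \<le> 2 c!\<close>, which is false for large \<open>q\<close>
  (\<open>big_orbit_subgroup\<close>).

  Finally, the index of a vertex in \<open>G\<close> is constant on a component up to powers of \<open>p\<close>
  (\<open>component_index\<close>), while \<open>supported S\<close> has index divisible by \<open>p ^ k + 1\<close>.  So a component
  contains the starting points for finitely many \<open>k\<close> only, and letting \<open>k\<close> vary gives infinitely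
  many components.
\<close>


section \<open>Indices of subgroups\<close>

lemma card_image_eq_of_same_kernel:
  assumes "\<And>a b. a \<in> X \<Longrightarrow> b \<in> X \<Longrightarrow> f a = f b \<longleftrightarrow> g a = g b"
  shows "card (f ` X) = card (g ` X)" and "finite (f ` X) \<longleftrightarrow> finite (g ` X)"
proof -
  let ?h = "g \<circ> inv_into X f"
  have h: "?h (f a) = g a" if "a \<in> X" for a
    using assms[of "inv_into X f (f a)" a] that by (simp add: f_inv_into_f inv_into_into)
  have "inj_on ?h (f ` X)"
    using h assms by (auto simp: inj_on_def)
  moreover have "?h ` f ` X = g ` X"
    using h by (force simp: image_iff)
  ultimately have "bij_betw ?h (f ` X) (g ` X)" by (simp add: bij_betw_def)
  then show "card (f ` X) = card (g ` X)" "finite (f ` X) \<longleftrightarrow> finite (g ` X)"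
    by (auto simp: bij_betw_same_card bij_betw_finite)
qed

context group
begin

lemma r_coset_eq_iff:
  assumes "subgroup C G" "a \<in> carrier G" "b \<in> carrier G"
  shows "C #> a = C #> b \<longleftrightarrow> a \<otimes> inv b \<in> C"
proof -
  interpret C: subgroup C G by fact
  have "C #> a = C #> b \<longleftrightarrow> a \<in> C #> b"
    using assms repr_independence repr_independenceD rcos_self by metis
  then show ?thesis using C.rcos_module[OF group_axioms assms(3,2)] by simp
qed

lemma inv_mult_cancel_left: "x \<in> carrier G \<Longrightarrow> y \<in> carrier G \<Longrightarrow> inv x \<otimes> (x \<otimes> y) = y"
  by (simp add: m_assoc[symmetric])

lemma rcosets_restrict: "rcosets\<^bsub>G\<lparr>carrier := A\<rparr>\<^esub> C = (\<lambda>a. C #> a) ` A"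
  by (auto simp: RCOSETS_def r_coset_def)

lemma rcosets_image: "rcosets C = (\<lambda>a. C #> a) ` carrier G"
  by (auto simp: RCOSETS_def)

text \<open>
  Every index below is computed by exhibiting a function on \<open>A\<close> whose fibres are the cosets
  of \<open>C\<close>.
\<close>

lemma index_in_eq_card_image:
  assumes "subgroup C G" "A \<subseteq> carrier G"
    and "\<And>a b. a \<in> A \<Longrightarrow> b \<in> A \<Longrightarrow> f a = f b \<longleftrightarrow> a \<otimes> inv b \<in> C"
  shows "index_in G A C = card (f ` A)"
    and "finite (rcosets\<^bsub>G\<lparr>carrier := A\<rparr>\<^esub> C) \<longleftrightarrow> finite (f ` A)"
proof -
  have *: "C #> a = C #> b \<longleftrightarrow> f a = f b" if "a \<in> A" "b \<in> A" for a b
    using assms that r_coset_eq_iff[of C a b] by auto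
  show "index_in G A C = card (f ` A)"
    unfolding index_in_def rcosets_restrict using card_image_eq_of_same_kernel(1)[OF *] .
  show "finite (rcosets\<^bsub>G\<lparr>carrier := A\<rparr>\<^esub> C) \<longleftrightarrow> finite (f ` A)"
    unfolding rcosets_restrict using card_image_eq_of_same_kernel(2)[OF *] .
qed

lemma index_in_tower:
  assumes A: "subgroup A G" and B: "subgroup B G" and C: "subgroup C G"
    and CB: "C \<subseteq> B" and BA: "B \<subseteq> A"
  shows "index_in G A C = index_in G A B * index_in G B C"
    and "finite (rcosets\<^bsub>G\<lparr>carrier := A\<rparr>\<^esub> B) \<Longrightarrow> finite (rcosets\<^bsub>G\<lparr>carrier := B\<rparr>\<^esub> C) \<Longrightarrow>
      finite (rcosets\<^bsub>G\<lparr>carrier := A\<rparr>\<^esub> C)"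
proof -
  interpret A: subgroup A G by fact
  interpret B: subgroup B G by fact
  interpret C: subgroup C G by fact
  (* writing a = b r with b in B and r a fixed representative of B a, the coset C a is
     determined by the pair of cosets (B a, C b), and every pair occurs *)
  define R where "R = (\<lambda>a. B #> a) ` A"
  define r where "r X = (SOME a. a \<in> A \<and> B #> a = X)" for X
  have r: "r X \<in> A" "B #> r X = X" if "X \<in> R" for X
  proof -
    have "\<exists>a. a \<in> A \<and> B #> a = X" using that by (auto simp: R_def)
    then have "r X \<in> A \<and> B #> r X = X" unfolding r_def by (rule someI_ex)
    then show "r X \<in> A" "B #> r X = X" by auto
  qed
  define f where "f a = (B #> a, C #> (a \<otimes> inv (r (B #> a))))" for a
  have rB: "a \<otimes> inv (r (B #> a)) \<in> B" if "a \<in> A" for a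
  proof -
    have "B #> a \<in> R" using that by (auto simp: R_def)
    then have "B #> a = B #> r (B #> a)" "r (B #> a) \<in> A" using r by auto
    then show ?thesis using r_coset_eq_iff[OF B, of a "r (B #> a)"] that by auto
  qed
  have img: "f ` A = R \<times> ((\<lambda>a. C #> a) ` B)"
  proof
    show "f ` A \<subseteq> R \<times> ((\<lambda>a. C #> a) ` B)"
      using rB by (auto simp: f_def R_def)
    show "R \<times> ((\<lambda>a. C #> a) ` B) \<subseteq> f ` A"
    proof clarify
      fix X b assume X: "X \<in> R" and b: "b \<in> B"
      let ?a = "b \<otimes> r X"
      have bA: "b \<in> A" using b BA by auto
      have cr: "r X \<in> carrier G" "b \<in> carrier G" using r(1)[OF X] b by auto
      have "?a \<in> A" using r(1)[OF X] bA by auto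
      moreover have "B #> ?a = X"
        using r(2)[OF X] r_coset_eq_iff[OF B, of ?a "r X"] cr b by (simp add: m_assoc)
      moreover have "?a \<otimes> inv (r X) = b" using cr by (simp add: m_assoc)
      ultimately show "(X, C #> b) \<in> f ` A" by (auto simp: f_def image_iff intro!: bexI[of _ ?a])
    qed
  qed
  have ker: "f a = f b \<longleftrightarrow> a \<otimes> inv b \<in> C" if ab: "a \<in> A" "b \<in> A" for a b
  proof -
    have cr: "a \<in> carrier G" "b \<in> carrier G" using ab by auto
    have "f a = f b \<longleftrightarrow> a \<otimes> inv b \<in> C" if eq: "B #> a = B #> b"
    proof -
      define x where "x = r (B #> b)"
      have x: "x \<in> carrier G" using r(1)[of "B #> b"] ab by (auto simp: x_def R_def)
      have "(a \<otimes> inv x) \<otimes> inv (b \<otimes> inv x) = a \<otimes> inv b"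
        using cr x by (simp add: m_assoc inv_mult_group inv_mult_cancel_left)
      then show ?thesis
        using r_coset_eq_iff[OF C, of "a \<otimes> inv x" "b \<otimes> inv x"] cr x eq
        by (simp add: f_def x_def)
    qed
    moreover have "B #> a = B #> b" if "a \<otimes> inv b \<in> C"
      using r_coset_eq_iff[OF B cr] that CB by auto
    ultimately show ?thesis by (auto simp: f_def)
  qed
  have "index_in G A C = card (R \<times> ((\<lambda>a. C #> a) ` B))"
    using index_in_eq_card_image(1)[OF C A.subset ker] img by simp
  then show "index_in G A C = index_in G A B * index_in G B C"
    by (simp add: card_cartesian_product index_in_def rcosets_restrict R_def)
  show "finite (rcosets\<^bsub>G\<lparr>carrier := A\<rparr>\<^esub> C)"
    if "finite (rcosets\<^bsub>G\<lparr>carrier := A\<rparr>\<^esub> B)" "finite (rcosets\<^bsub>G\<lparr>carrier := B\<rparr>\<^esub> C)"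
    using index_in_eq_card_image(2)[OF C A.subset ker] img that
    by (simp add: rcosets_restrict R_def)
qed

lemma card_subgroup_eq_index_mult:
  assumes "subgroup A G" "subgroup C G" "C \<subseteq> A"
  shows "card A = index_in G A C * card C"
  using group.lagrange[OF subgroup_imp_group[OF assms(1)], of C]
    subgroup_incl[OF assms(2,1,3)] by (simp add: index_in_def order_def)

text \<open>
  A normal subgroup \<open>N\<close> meets both sides of the inclusion \<open>D \<subseteq> B\<close> without creating new
  factors in the index, because \<open>(N \<inter> B) D\<close> is a subgroup lying between \<open>D\<close> and \<open>B\<close>.
\<close>

lemma index_in_Int_normal_dvd:
  assumes N: "N \<lhd> G" and B: "subgroup B G" and D: "subgroup D G" and DB: "D \<subseteq> B"
  shows "index_in G (B \<inter> N) (D \<inter> N) dvd index_in G B D"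
proof -
  interpret N: normal N G by fact
  interpret B: subgroup B G by fact
  interpret D: subgroup D G by fact
  define E where "E = D <#> (B \<inter> N)"
  have E_iff: "x \<in> E \<longleftrightarrow> (\<exists>d\<in>D. \<exists>m\<in>B \<inter> N. x = d \<otimes> m)" for x
    by (auto simp: E_def set_mult_def)
  have conj: "inv d \<otimes> m \<otimes> d \<in> B \<inter> N" if "d \<in> D" "m \<in> B \<inter> N" for d m
    using that DB N.inv_op_closed1[of d m] by auto
  have E: "subgroup E G"
  proof (rule subgroupI)
    show "E \<subseteq> carrier G" by (auto simp: E_iff)
    show "E \<noteq> {}" using E_iff D.one_closed B.one_closed N.one_closed by blast
  next
    fix x assume "x \<in> E"
    then obtain d m where dm: "d \<in> D" "m \<in> B \<inter> N" "x = d \<otimes> m" by (auto simp: E_iff)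
    then have c: "d \<in> carrier G" "m \<in> carrier G" by auto
    have "inv x = inv d \<otimes> (inv (inv d) \<otimes> inv m \<otimes> inv d)"
      using dm c by (simp add: inv_mult_group m_assoc[symmetric])
    moreover have "inv (inv d) \<otimes> inv m \<otimes> inv d \<in> B \<inter> N" "inv d \<in> D"
      using conj[of "inv d" "inv m"] dm by auto
    ultimately show "inv x \<in> E" by (auto simp: E_iff)
  next
    fix x y assume "x \<in> E" "y \<in> E"
    then obtain d m d' m' where dm: "d \<in> D" "m \<in> B \<inter> N" "x = d \<otimes> m"
      "d' \<in> D" "m' \<in> B \<inter> N" "y = d' \<otimes> m'" by (auto simp: E_iff)
    then have c: "d \<in> carrier G" "m \<in> carrier G" "d' \<in> carrier G" "m' \<in> carrier G" by auto
    have "d \<otimes> d' \<otimes> (inv d' \<otimes> m \<otimes> d' \<otimes> m') = d \<otimes> (d' \<otimes> inv d') \<otimes> m \<otimes> d' \<otimes> m'"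
      using c by (simp only: m_assoc m_closed inv_closed)
    also have "\<dots> = x \<otimes> y"
      using c dm by (simp add: m_assoc)
    finally have "x \<otimes> y = (d \<otimes> d') \<otimes> ((inv d' \<otimes> m \<otimes> d') \<otimes> m')" ..
    moreover have "(inv d' \<otimes> m \<otimes> d') \<otimes> m' \<in> B \<inter> N" "d \<otimes> d' \<in> D"
      using conj[of d' m] dm by auto
    ultimately show "x \<otimes> y \<in> E" by (auto simp: E_iff)
  qed
  have DE: "D \<subseteq> E"
  proof
    fix d assume d: "d \<in> D"
    then have "d = d \<otimes> \<one>" by auto
    then show "d \<in> E" unfolding E_iff using d B.one_closed N.one_closed by blast
  qed
  have EB: "E \<subseteq> B" using subsetD[OF DB] by (auto simp: E_iff)
  have DN: "subgroup (D \<inter> N) G" using subgroups_Inter_pair[OF D N.is_subgroup] .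
  have "index_in G (B \<inter> N) (D \<inter> N) = card ((\<lambda>m. D #> m) ` (B \<inter> N))"
  proof (rule index_in_eq_card_image(1)[OF DN])
    fix a b assume "a \<in> B \<inter> N" "b \<in> B \<inter> N"
    then show "D #> a = D #> b \<longleftrightarrow> a \<otimes> inv b \<in> D \<inter> N"
      using r_coset_eq_iff[OF D, of a b] by auto
  qed auto
  also have "(\<lambda>m. D #> m) ` (B \<inter> N) = (\<lambda>m. D #> m) ` E"
  proof
    show "(\<lambda>m. D #> m) ` E \<subseteq> (\<lambda>m. D #> m) ` (B \<inter> N)"
    proof clarify
      fix x assume "x \<in> E"
      then obtain d m where dm: "d \<in> D" "m \<in> B \<inter> N" "x = d \<otimes> m" by (auto simp: E_iff)
      then have "D #> x = D #> m"
        using r_coset_eq_iff[OF D, of x m] by (auto simp: m_assoc)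
      then show "D #> x \<in> (\<lambda>m. D #> m) ` (B \<inter> N)" using dm by auto
    qed
    have "B \<inter> N \<subseteq> E"
    proof
      fix m assume m: "m \<in> B \<inter> N"
      then have "m = \<one> \<otimes> m" by auto
      then show "m \<in> E" unfolding E_iff using m D.one_closed by blast
    qed
    then show "(\<lambda>m. D #> m) ` (B \<inter> N) \<subseteq> (\<lambda>m. D #> m) ` E" by auto
  qed
  also have "card \<dots> = index_in G E D" by (simp add: index_in_def rcosets_restrict)
  finally have "index_in G B D = index_in G B E * index_in G (B \<inter> N) (D \<inter> N)"
    using index_in_tower(1)[OF B E D DE EB] by simp
  then show ?thesis by simp
qed

text \<open>
  The elements of \<open>X\<close> whose image lies in \<open>h ` Y\<close> form a subgroup between \<open>Y\<close> and \<open>X\<close>, and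
  its index in \<open>X\<close> is the index of the images.
\<close>

lemma index_in_hom_image_dvd:
  assumes X: "subgroup X G" and Y: "subgroup Y G" and YX: "Y \<subseteq> X"
    and K: "group K" and h: "h \<in> hom (G\<lparr>carrier := X\<rparr>) K"
  shows "index_in K (h ` X) (h ` Y) dvd index_in G X Y"
proof -
  interpret K: group K by fact
  interpret X: subgroup X G by fact
  interpret Y: subgroup Y G by fact
  interpret GX: group "G\<lparr>carrier := X\<rparr>" using X.subgroup_is_group group_axioms by blast
  interpret h: group_hom "G\<lparr>carrier := X\<rparr>" K h
    using h by unfold_locales
  have hm: "h (a \<otimes> b) = h a \<otimes>\<^bsub>K\<^esub> h b" if "a \<in> X" "b \<in> X" for a b
    using h.hom_mult[of a b] that by simp
  have hi: "h (inv a) = inv\<^bsub>K\<^esub> h a" if "a \<in> X" for a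
    using h.hom_inv[of a] that X m_inv_consistent by simp
  have hc: "h a \<in> carrier K" if "a \<in> X" for a using h.hom_closed[of a] that by simp
  have YX': "subgroup Y (G\<lparr>carrier := X\<rparr>)" using subgroup_incl[OF Y X YX] .
  have hY: "subgroup (h ` Y) K" using h.subgroup_img_is_subgroup[OF YX'] .
  define Z where "Z = {x \<in> X. h x \<in> h ` Y}"
  have Z: "subgroup Z G"
  proof (rule subgroupI)
    show "Z \<subseteq> carrier G" by (auto simp: Z_def)
    show "Z \<noteq> {}" unfolding Z_def using YX Y.one_closed by blast
    fix a assume a: "a \<in> Z"
    then show "inv a \<in> Z"
      using subgroup.m_inv_closed[OF hY] by (auto simp: Z_def hi)
    fix b assume "b \<in> Z"
    with a show "a \<otimes> b \<in> Z"
      using subgroup.m_closed[OF hY] by (auto simp: Z_def hm)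
  qed
  have "index_in G X Z = card ((\<lambda>x. (h ` Y) #>\<^bsub>K\<^esub> h x) ` X)"
  proof (rule index_in_eq_card_image(1)[OF Z X.subset])
    fix a b assume ab: "a \<in> X" "b \<in> X"
    then show "(h ` Y) #>\<^bsub>K\<^esub> h a = (h ` Y) #>\<^bsub>K\<^esub> h b \<longleftrightarrow> a \<otimes> inv b \<in> Z"
      using K.r_coset_eq_iff[OF hY, of "h a" "h b"] hc by (auto simp: Z_def hm hi)
  qed
  also have "\<dots> = index_in K (h ` X) (h ` Y)"
    by (simp add: index_in_def K.rcosets_restrict image_image)
  finally have "index_in G X Y = index_in K (h ` X) (h ` Y) * index_in G Z Y"
    using index_in_tower(1)[OF X Z Y] YX by (auto simp: Z_def subset_iff)
  then show ?thesis by simp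
qed

lemma finite_index_tower:
  assumes A: "finite_index G A" and C: "subgroup C G" "C \<subseteq> A"
    and fin: "finite (rcosets\<^bsub>G\<lparr>carrier := A\<rparr>\<^esub> C)"
  shows "finite_index G C"
proof -
  have "subgroup A G" "finite (rcosets A)" using A by (auto simp: finite_index_def)
  then show ?thesis
    using index_in_tower(2)[of "carrier G" A C] C fin subgroup_self
    by (auto simp: finite_index_def subgroup.subset)
qed

lemma index_in_carrier_pos: "finite_index G A \<Longrightarrow> index_in G (carrier G) A > 0"
  by (auto simp: index_in_def finite_index_def card_gt_0_iff rcosets_image)

text \<open>
  The normal core of \<open>H\<close> is the kernel of the action by right translation on the finitely many
  cosets of \<open>H\<close>, so its own cosets correspond to some of the finitely many self-maps of that set.
\<close>

lemma finite_index_normal_core: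
  assumes "finite_index G H"
  obtains N where "N \<lhd> G" "finite_index G N" "N \<subseteq> H"
proof -
  have H: "subgroup H G" and fin: "finite (rcosets H)" using assms by (auto simp: finite_index_def)
  interpret H: subgroup H G by fact
  define N where "N = {g \<in> carrier G. \<forall>x\<in>carrier G. x \<otimes> g \<otimes> inv x \<in> H}"
  have sub: "subgroup N G"
  proof (rule subgroupI)
    show "N \<subseteq> carrier G" by (auto simp: N_def)
    have "\<one> \<in> N" by (auto simp: N_def)
    then show "N \<noteq> {}" by auto
  next
    fix a assume a: "a \<in> N"
    have "x \<otimes> inv a \<otimes> inv x \<in> H" if x: "x \<in> carrier G" for x
    proof -
      have "x \<otimes> inv a \<otimes> inv x = inv (x \<otimes> a \<otimes> inv x)"
        using a x by (simp add: N_def inv_mult_group m_assoc)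
      then show ?thesis using a x by (auto simp: N_def)
    qed
    then show "inv a \<in> N" using a by (auto simp: N_def)
  next
    fix a b assume ab: "a \<in> N" "b \<in> N"
    have "x \<otimes> (a \<otimes> b) \<otimes> inv x \<in> H" if x: "x \<in> carrier G" for x
    proof -
      have "x \<otimes> (a \<otimes> b) \<otimes> inv x = (x \<otimes> a \<otimes> inv x) \<otimes> (x \<otimes> b \<otimes> inv x)"
        using ab x by (simp add: N_def m_assoc inv_mult_cancel_left)
      then show ?thesis using ab x by (auto simp: N_def)
    qed
    then show "a \<otimes> b \<in> N" using ab by (auto simp: N_def)
  qed
  have normal: "N \<lhd> G"
  proof (unfold normal_inv_iff, intro conjI ballI sub)
    fix x a assume x: "x \<in> carrier G" and a: "a \<in> N"
    have "y \<otimes> (x \<otimes> a \<otimes> inv x) \<otimes> inv y \<in> H" if y: "y \<in> carrier G" for y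
    proof -
      have "y \<otimes> (x \<otimes> a \<otimes> inv x) \<otimes> inv y = (y \<otimes> x) \<otimes> a \<otimes> inv (y \<otimes> x)"
        using a x y by (simp add: N_def m_assoc inv_mult_group)
      then show ?thesis using a x y by (auto simp: N_def)
    qed
    then show "x \<otimes> a \<otimes> inv x \<in> N" using a x by (auto simp: N_def)
  qed
  define f where "f g = (\<lambda>R\<in>rcosets H. R #> g)" for g
  have "finite (rcosets\<^bsub>G\<lparr>carrier := carrier G\<rparr>\<^esub> N) \<longleftrightarrow> finite (f ` carrier G)"
  proof (rule index_in_eq_card_image(2)[OF sub])
    fix a b assume ab: "a \<in> carrier G" "b \<in> carrier G"
    have "f a = f b \<longleftrightarrow> (\<forall>R\<in>rcosets H. R #> a = R #> b)"
      by (auto simp: f_def fun_eq_iff restrict_def)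
    also have "\<dots> \<longleftrightarrow> (\<forall>x\<in>carrier G. H #> (x \<otimes> a) = H #> (x \<otimes> b))"
      using ab by (simp add: rcosets_image coset_mult_assoc H.subset)
    also have "\<dots> \<longleftrightarrow> (\<forall>x\<in>carrier G. x \<otimes> (a \<otimes> inv b) \<otimes> inv x \<in> H)"
      using ab r_coset_eq_iff[OF H] by (simp add: inv_mult_group m_assoc)
    finally show "f a = f b \<longleftrightarrow> a \<otimes> inv b \<in> N" using ab by (simp add: N_def)
  qed simp
  moreover have "f ` carrier G \<subseteq> rcosets H \<rightarrow>\<^sub>E rcosets H"
    by (auto simp: f_def rcosets_image coset_mult_assoc H.subset)
  ultimately have "finite (rcosets N)"
    using fin finite_subset finite_PiE by (metis (no_types, lifting) partial_object.update_convs(1) partial_object.surjective)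
  then have "finite_index G N" using sub by (simp add: finite_index_def)
  moreover have "N \<subseteq> H"
  proof
    fix g assume g: "g \<in> N"
    then have "\<one> \<otimes> g \<otimes> inv \<one> \<in> H" unfolding N_def by blast
    with g show "g \<in> H" by (simp add: N_def)
  qed
  ultimately show ?thesis using normal that by blast
qed

end

section \<open>Orbits and orders of permutation groups\<close>

abbreviation perm_orbit :: "(nat \<Rightarrow> nat) set \<Rightarrow> nat \<Rightarrow> nat set" where
  "perm_orbit C y \<equiv> (\<lambda>f. f y) ` C"

lemma subgroup_sym_groupD:
  assumes "subgroup C (sym_group n)"
  shows "id \<in> C" and "f \<in> C \<Longrightarrow> g \<in> C \<Longrightarrow> f \<circ> g \<in> C" and "f \<in> C \<Longrightarrow> inv' f \<in> C"
    and "f \<in> C \<Longrightarrow> f permutes {1..n}"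
proof -
  interpret C: subgroup C "sym_group n" by fact
  show "id \<in> C" using C.one_closed by (simp add: sym_group_one)
  show "f \<circ> g \<in> C" if "f \<in> C" "g \<in> C" using C.m_closed[OF that] by (simp add: sym_group_mult)
  show "inv' f \<in> C" if "f \<in> C" using C.m_inv_closed[OF that] that by simp
  show "f permutes {1..n}" if "f \<in> C" using C.mem_carrier[OF that] by (simp add: sym_group_carrier)
qed

lemma subgroup_sym_groupI:
  assumes "\<And>f. f \<in> C \<Longrightarrow> f permutes {1..n}" "id \<in> C"
    "\<And>f g. f \<in> C \<Longrightarrow> g \<in> C \<Longrightarrow> f \<circ> g \<in> C" "\<And>f. f \<in> C \<Longrightarrow> inv' f \<in> C"
  shows "subgroup C (sym_group n)"
proof (rule group.subgroupI[OF sym_group_is_group])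
  show "C \<subseteq> carrier (sym_group n)" using assms(1) by (auto simp: sym_group_carrier)
  show "C \<noteq> {}" using assms(2) by auto
  fix f assume f: "f \<in> C"
  then have "f \<in> carrier (sym_group n)" using assms(1) by (auto simp: sym_group_carrier)
  then show "inv\<^bsub>sym_group n\<^esub> f \<in> C" using assms(4) f by simp
  fix g assume "g \<in> C"
  with f show "f \<otimes>\<^bsub>sym_group n\<^esub> g \<in> C" using assms(3) by (simp add: sym_group_mult)
qed

lemma (in group) index_in_stabilizer:
  assumes A: "subgroup A G" and h: "h \<in> hom (G\<lparr>carrier := A\<rparr>) (sym_group n)"
  shows "subgroup {a \<in> A. h a y = y} G"
    and "index_in G A {a \<in> A. h a y = y} = card (perm_orbit (h ` A) y)"
    and "finite (rcosets\<^bsub>G\<lparr>carrier := A\<rparr>\<^esub> {a \<in> A. h a y = y}) \<longleftrightarrow> finite (perm_orbit (h ` A) y)"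
proof -
  interpret A: subgroup A G by fact
  interpret S: group "sym_group n" by (rule sym_group_is_group)
  interpret GA: group "G\<lparr>carrier := A\<rparr>" using A.subgroup_is_group group_axioms by blast
  interpret h: group_hom "G\<lparr>carrier := A\<rparr>" "sym_group n" h using h by unfold_locales
  have hp: "h a permutes {1..n}" if "a \<in> A" for a
    using h.hom_closed[of a] that by (simp add: sym_group_carrier)
  have hm: "h (a \<otimes> b) = h a \<circ> h b" if "a \<in> A" "b \<in> A" for a b
    using h.hom_mult[of a b] that by (simp add: sym_group_mult)
  have hi: "h (inv a) = inv' (h a)" if "a \<in> A" for a
    using h.hom_inv[of a] that A m_inv_consistent h.hom_closed[of a] by simp
  have h1: "h \<one> = id" using h.hom_one by (simp add: sym_group_one)
  have inv_y: "inv' (h a) y = z \<longleftrightarrow> h a z = y" if "a \<in> A" for a z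
    using permutes_inv_eq[OF hp[OF that]] by auto
  show sub: "subgroup {a \<in> A. h a y = y} G"
  proof (rule subgroupI)
    show "{a \<in> A. h a y = y} \<subseteq> carrier G" by auto
    have "\<one> \<in> {a \<in> A. h a y = y}" using h1 by simp
    then show "{a \<in> A. h a y = y} \<noteq> {}" by blast
    fix a assume a: "a \<in> {a \<in> A. h a y = y}"
    then show "inv a \<in> {a \<in> A. h a y = y}" using hi inv_y by simp
    fix b assume "b \<in> {a \<in> A. h a y = y}"
    with a show "a \<otimes> b \<in> {a \<in> A. h a y = y}" using hm by simp
  qed
  (* right cosets of a stabilizer are the fibres of the inverse action *)
  define f where "f a = inv' (h a) y" for a
  have ker: "f a = f b \<longleftrightarrow> a \<otimes> inv b \<in> {a \<in> A. h a y = y}" if "a \<in> A" "b \<in> A" for a b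
    using that hm[of a "inv b"] hi[of b] inv_y by (auto simp: f_def)
  have "f a = h (inv a) y" if "a \<in> A" for a using hi that by (simp add: f_def)
  then have "f ` A = (\<lambda>a. h (inv a) y) ` A" by auto
  also have "\<dots> = (\<lambda>a. h a y) ` (\<lambda>a. inv a) ` A" by (simp add: image_image)
  also have "(\<lambda>a. inv a) ` A = A"
  proof
    show "A \<subseteq> (\<lambda>a. inv a) ` A"
    proof
      fix a assume "a \<in> A"
      then have "a = inv (inv a)" "inv a \<in> A" by auto
      then show "a \<in> (\<lambda>a. inv a) ` A" by blast
    qed
  qed auto
  finally have img: "f ` A = perm_orbit (h ` A) y" by (simp add: image_image)
  show "index_in G A {a \<in> A. h a y = y} = card (perm_orbit (h ` A) y)"
    using index_in_eq_card_image(1)[OF sub A.subset ker] img by simp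
  show "finite (rcosets\<^bsub>G\<lparr>carrier := A\<rparr>\<^esub> {a \<in> A. h a y = y}) \<longleftrightarrow> finite (perm_orbit (h ` A) y)"
    using index_in_eq_card_image(2)[OF sub A.subset ker] img by simp
qed

lemma finite_subgroup_sym_group: "subgroup C (sym_group n) \<Longrightarrow> finite C"
  using finite_subset[of C "{f. f permutes {1..n}}"] finite_permutations[of "{1..n}"]
    subgroup_sym_groupD(4)[of C n] by blast

lemma id_in_hom_subgroup: "id \<in> hom (G\<lparr>carrier := A\<rparr>) G" if "A \<subseteq> carrier G"
  using that by (auto simp: hom_def)

lemma card_eq_orbit_mult_stabilizer:
  assumes C: "subgroup C (sym_group n)"
  shows "subgroup {f \<in> C. f y = y} (sym_group n)"
    and "card C = card (perm_orbit C y) * card {f \<in> C. f y = y}"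
proof -
  interpret S: group "sym_group n" by (rule sym_group_is_group)
  note st = S.index_in_stabilizer[OF C id_in_hom_subgroup[OF subgroup.subset[OF C]], of y]
  show sub: "subgroup {f \<in> C. f y = y} (sym_group n)" using st(1) by simp
  show "card C = card (perm_orbit C y) * card {f \<in> C. f y = y}"
    using S.card_subgroup_eq_index_mult[OF C sub] st(2) by auto
qed

lemma perm_orbit_self: "subgroup C (sym_group n) \<Longrightarrow> y \<in> perm_orbit C y"
  using subgroup_sym_groupD(1) by (metis id_apply image_eqI)

lemma perm_orbit_subset: "subgroup C (sym_group n) \<Longrightarrow> y \<in> {1..n} \<Longrightarrow> perm_orbit C y \<subseteq> {1..n}"
  using permutes_in_image[OF subgroup_sym_groupD(4)] by (intro image_subsetI) blast

lemma perm_orbit_closed: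
  assumes "subgroup C (sym_group n)" "f \<in> C" "x \<in> perm_orbit C y"
  shows "f x \<in> perm_orbit C y"
proof -
  obtain g where "g \<in> C" "x = g y" using assms by auto
  then show ?thesis using subgroup_sym_groupD(2)[OF assms(1,2), of g] by (metis comp_apply image_eqI)
qed

lemma perm_orbit_eq:
  assumes C: "subgroup C (sym_group n)" and x: "x \<in> perm_orbit C y"
  shows "perm_orbit C x = perm_orbit C y"
proof
  show "perm_orbit C x \<subseteq> perm_orbit C y" using perm_orbit_closed[OF C _ x] by auto
  obtain g where g: "g \<in> C" "x = g y" using x by auto
  then have "y = inv' g x" using subgroup_sym_groupD(4)[OF C] permutes_inverses(2) by metis
  then have "y \<in> perm_orbit C x" using subgroup_sym_groupD(3)[OF C g(1)] by blast
  then show "perm_orbit C y \<subseteq> perm_orbit C x" using perm_orbit_closed[OF C] by auto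
qed

lemma finite_perm_orbit: "subgroup C (sym_group n) \<Longrightarrow> finite (perm_orbit C y)"
  using finite_subgroup_sym_group by blast

lemma card_perm_orbit_pos: "subgroup C (sym_group n) \<Longrightarrow> card (perm_orbit C y) > 0"
  using finite_perm_orbit perm_orbit_self card_gt_0_iff by blast

lemma card_subgroup_dvd:
  assumes "subgroup C (sym_group n)" "subgroup E (sym_group n)" "E \<subseteq> C"
  shows "card E dvd card C"
  using group.card_subgroup_eq_index_mult[OF sym_group_is_group assms] by simp

text \<open>
  The arithmetic that drives the lower bound: both orders are orbit length times stabilizer
  order, and the stabilizer in \<open>E\<close> has order dividing that of the stabilizer in \<open>C\<close>.
\<close>

lemma card_perm_orbit_dvd:
  assumes C: "subgroup C (sym_group n)" and E: "subgroup E (sym_group n)" and EC: "E \<subseteq> C"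
    and card: "card C = m * card E"
  shows "card (perm_orbit C y) dvd m * card (perm_orbit E y)"
proof -
  note sC = card_eq_orbit_mult_stabilizer[OF C, of y]
  note sE = card_eq_orbit_mult_stabilizer[OF E, of y]
  have "card {f \<in> E. f y = y} dvd card {f \<in> C. f y = y}"
    using card_subgroup_dvd[OF sC(1) sE(1)] EC by blast
  then obtain z where z: "card {f \<in> C. f y = y} = card {f \<in> E. f y = y} * z" by (elim dvdE)
  have "{f \<in> E. f y = y} \<noteq> {}" using subgroup_sym_groupD(1)[OF sE(1)] by blast
  then have "card {f \<in> E. f y = y} > 0"
    using finite_subgroup_sym_group[OF sE(1)] by (simp add: card_gt_0_iff)
  moreover have "card {f \<in> E. f y = y} * (m * card (perm_orbit E y)) = m * card E"
    using sE(2) by simp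
  moreover have "card {f \<in> E. f y = y} * (card (perm_orbit C y) * z) = card C"
    using sC(2) z by simp
  ultimately have "card {f \<in> E. f y = y} * (m * card (perm_orbit E y)) =
      card {f \<in> E. f y = y} * (card (perm_orbit C y) * z)"
    and "card {f \<in> E. f y = y} \<noteq> 0"
    using card by (simp_all only: neq0_conv)
  then have "m * card (perm_orbit E y) = card (perm_orbit C y) * z"
    by (simp only: mult_cancel1) blast
  then show ?thesis by simp
qed

lemma permutes_invariant_subset:
  assumes "f permutes S" "finite T" "f ` T \<subseteq> T"
  shows "f ` T = T" and "\<And>x. f x \<in> T \<longleftrightarrow> x \<in> T"
proof -
  have inj: "inj f" using assms(1) by (rule permutes_inj)
  show eq: "f ` T = T"
    using assms(2,3) inj by (simp add: endo_inj_surj inj_on_subset)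
  show "f x \<in> T \<longleftrightarrow> x \<in> T" for x using eq inj by (metis inj_image_mem_iff)
qed

text \<open>
  Restricting a permutation group to an invariant set \<open>T\<close> has an image of order dividing
  \<open>(card T)!\<close>; the second factor is the kernel of the restriction.
\<close>

lemma card_pointwise_stabilizer:
  assumes C: "subgroup C (sym_group n)" and T: "T \<subseteq> {1..n}"
    and inv: "\<And>f. f \<in> C \<Longrightarrow> f ` T \<subseteq> T"
  shows "subgroup {f \<in> C. \<forall>x\<in>T. f x = x} (sym_group n)"
    and "\<exists>d. d dvd fact (card T) \<and> card C = d * card {f \<in> C. \<forall>x\<in>T. f x = x}"
proof -
  interpret S: group "sym_group n" by (rule sym_group_is_group)
  have finT: "finite T" using T finite_subset by blast
  note D = subgroup_sym_groupD[OF C]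
  have mem: "f x \<in> T \<longleftrightarrow> x \<in> T" if "f \<in> C" for f x
    using permutes_invariant_subset(2)[OF D(4)[OF that] finT inv[OF that]] .
  have inv_eq: "inv' f x = z \<longleftrightarrow> f z = x" if "f \<in> C" for f x z
    using permutes_inv_eq[OF D(4)[OF that]] by auto
  let ?F = "{f \<in> C. \<forall>x\<in>T. f x = x}"
  show F: "subgroup ?F (sym_group n)"
    by (rule subgroup_sym_groupI) (auto simp: D inv_eq simp del: One_nat_def)
  define r where "r f = (\<lambda>x. if x \<in> T then f x else x)" for f :: "nat \<Rightarrow> nat"
  have ker: "r (inv' f) = r (inv' g) \<longleftrightarrow> f \<otimes>\<^bsub>sym_group n\<^esub> inv\<^bsub>sym_group n\<^esub> g \<in> ?F"
    if "f \<in> C" "g \<in> C" for f g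
  proof -
    have "g \<in> carrier (sym_group n)" using subgroup.mem_carrier[OF C that(2)] .
    moreover have "f \<circ> inv' g \<in> C" using D that by blast
    moreover have "r (inv' f) = r (inv' g) \<longleftrightarrow> (\<forall>x\<in>T. inv' f x = inv' g x)"
      by (auto simp: r_def fun_eq_iff)
    moreover have "inv' f x = inv' g x \<longleftrightarrow> f (inv' g x) = x" for x
      using inv_eq[OF that(1)] by auto
    ultimately show ?thesis by (simp add: sym_group_mult)
  qed
  have im: "(\<lambda>f. r (inv' f)) ` C = r ` C"
  proof -
    have "inv' ` C = C"
    proof
      show "inv' ` C \<subseteq> C" using D(3) by auto
      show "C \<subseteq> inv' ` C"
      proof
        fix f assume f: "f \<in> C"
        then have "f = inv' (inv' f)" using D(4) permutes_inv_inv by metis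
        then show "f \<in> inv' ` C" using D(3)[OF f] by blast
      qed
    qed
    then have "r ` (inv' ` C) = r ` C" by (rule arg_cong)
    then show ?thesis by (simp add: image_image)
  qed
  have idx: "index_in (sym_group n) C ?F = card (r ` C)"
    using S.index_in_eq_card_image(1)[OF F subgroup.subset[OF C] ker] im by simp
  have rp: "r f permutes T" if "f \<in> C" for f
  proof (rule bij_imp_permutes)
    have "bij_betw f T T"
      using permutes_invariant_subset(1)[OF D(4)[OF that] finT inv[OF that]]
        permutes_inj_on[OF D(4)[OF that]] by (simp add: bij_betw_def)
    then show "bij_betw (r f) T T" by (rule bij_betw_cong[THEN iffD1, rotated]) (simp add: r_def)
  qed (simp add: r_def)
  have rc: "r f \<circ> r g = r (f \<circ> g)" if "g \<in> C" for f g
    using mem[OF that] by (auto simp: r_def fun_eq_iff)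
  have R: "subgroup (r ` C) (sym_group n)"
  proof (rule subgroup_sym_groupI)
    show "f permutes {1..n}" if "f \<in> r ` C" for f using that rp T permutes_subset by blast
    show "id \<in> r ` C" 
    proof -
      have "r id = id" by (auto simp: r_def)
      then show ?thesis using D(1) by (metis image_eqI)
    qed
    show "f \<circ> g \<in> r ` C" if "f \<in> r ` C" "g \<in> r ` C" for f g
      using that rc D(2) by auto
    show "inv' f \<in> r ` C" if fr: "f \<in> r ` C" for f
    proof -
      obtain g where g: "g \<in> C" "f = r g" using fr by auto
      have "r g \<circ> r (inv' g) = r (g \<circ> inv' g)" using rc D(3)[OF g(1)] by simp
      also have "\<dots> = id" using permutes_inv_o(1)[OF D(4)[OF g(1)]] by (auto simp: r_def)
      finally have "inv' (r g) = r (inv' g)"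
        using permutes_bij[OF rp[OF g(1)]] by (metis bij_betw_def comp_assoc comp_id id_comp inj_iff)
      then show ?thesis using g D(3) by auto
    qed
  qed
  have P: "subgroup {f. f permutes T} (sym_group n)"
    by (rule subgroup_sym_groupI)
      (use T permutes_subset in \<open>auto simp: permutes_inv permutes_compose permutes_id\<close>)
  have "card (r ` C) dvd card {f. f permutes T}" by (rule card_subgroup_dvd[OF P R]) (use rp in auto)
  also have "card {f. f permutes T} = fact (card T)" by (rule card_permutations) (use finT in auto)
  finally have "card (r ` C) dvd fact (card T)" .
  moreover have "card C = card (r ` C) * card ?F"
    using S.card_subgroup_eq_index_mult[OF C F] idx by auto
  ultimately show "\<exists>d. d dvd fact (card T) \<and> card C = d * card ?F" by blast
qed

text \<open>
  Peel off \<open>T\<close>, then \<open>U - T\<close>, then the complement of \<open>U\<close>; what remains fixes every point.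
\<close>

lemma card_dvd_of_invariant_subset:
  assumes C: "subgroup C (sym_group n)" and U: "U \<subseteq> {1..n}" and T: "T \<subseteq> U"
    and invU: "\<And>f. f \<in> C \<Longrightarrow> f ` U \<subseteq> U" and invT: "\<And>f. f \<in> C \<Longrightarrow> f ` T \<subseteq> T"
  shows "card C dvd fact (card T) * fact (card U - card T) * fact (n - card U)"
proof -
  have finU: "finite U" and finT: "finite T" using U T by (auto intro: finite_subset)
  note memU = permutes_invariant_subset(2)[OF subgroup_sym_groupD(4)[OF C] finU invU]
  note memT = permutes_invariant_subset(2)[OF subgroup_sym_groupD(4)[OF C] finT invT]
  have TU: "T \<subseteq> {1..n}" using T U by auto
  define C1 where "C1 = {f \<in> C. \<forall>x\<in>T. f x = x}"
  note s1 = card_pointwise_stabilizer[OF C TU invT, folded C1_def]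
  have C1: "f ` (U - T) \<subseteq> U - T" if "f \<in> C1" for f using that memU memT by (auto simp: C1_def)
  define C2 where "C2 = {f \<in> C1. \<forall>x\<in>U - T. f x = x}"
  have "U - T \<subseteq> {1..n}" using U by auto
  note s2 = card_pointwise_stabilizer[OF s1(1) this C1, folded C2_def]
  have C2: "f ` ({1..n} - U) \<subseteq> {1..n} - U" if f: "f \<in> C2" for f
  proof -
    have fC: "f \<in> C" using f by (simp add: C1_def C2_def)
    show ?thesis using memU[OF fC fC] permutes_in_image[OF subgroup_sym_groupD(4)[OF C fC]] by blast
  qed
  define C3 where "C3 = {f \<in> C2. \<forall>x\<in>{1..n} - U. f x = x}"
  have "{1..n} - U \<subseteq> {1..n}" by auto
  note s3 = card_pointwise_stabilizer[OF s2(1) this C2, folded C3_def]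
  have "f = id" if f: "f \<in> C3" for f
  proof
    fix x
    have fC: "f \<in> C" using f by (simp add: C1_def C2_def C3_def)
    show "f x = id x"
    proof (cases "x \<in> {1..n}")
      case True
      then have "x \<in> T \<or> x \<in> U - T \<or> x \<in> {1..n} - U" by blast
      then show ?thesis using f unfolding C1_def C2_def C3_def id_apply by blast
    next
      case False
      then show ?thesis using permutes_not_in[OF subgroup_sym_groupD(4)[OF C fC]] by simp
    qed
  qed
  then have "C3 = {id}" using subgroup_sym_groupD(1)[OF s3(1)] by blast
  then have C3: "card C3 = 1" by simp
  obtain d1 d2 d3 where d: "d1 dvd fact (card T)" "card C = d1 * card C1"
    "d2 dvd fact (card (U - T))" "card C1 = d2 * card C2"
    "d3 dvd fact (card ({1..n} - U))" "card C2 = d3 * card C3"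
    using s1(2) s2(2) s3(2) by blast
  have "card (U - T) = card U - card T" using finT T by (simp add: card_Diff_subset)
  moreover have "card ({1..n} - U) = n - card U" using finU U by (simp add: card_Diff_subset)
  moreover have "card C = d1 * d2 * d3" using d C3 by simp
  moreover have "d1 * d2 * d3 dvd fact (card T) * fact (card (U - T)) * fact (card ({1..n} - U))"
    using d by (intro mult_dvd_mono)
  ultimately show ?thesis by simp
qed

section \<open>Binomial coefficients of prime powers\<close>

text \<open>
  By Pascal's rule two neighbours in this row of the triangle add up to an entry
  \<open>p ^ k choose j\<close>, which \<open>p\<close> divides; so non-divisibility propagates from \<open>j = 0\<close>.
\<close>

lemma prime_not_dvd_choose_prime_power_minus_1:
  fixes p :: nat
  assumes p: "prime p" and "j < p ^ k"
  shows "\<not> p dvd ((p ^ k - 1) choose j)"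
  using assms(2)
proof (induction j)
  case 0
  then show ?case using p by (simp add: prime_nat_iff)
next
  case (Suc j)
  let ?q = "p ^ k"
  have q: "?q > 0" using p by (simp add: prime_gt_0_nat)
  have "Suc j * (?q choose Suc j) = ?q * ((?q - 1) choose j)"
    using q Suc_times_binomial_eq[of "?q - 1" j] by (simp add: mult.commute)
  then have dvd: "p ^ k dvd Suc j * (?q choose Suc j)" by simp
  have "p dvd (?q choose Suc j)"
  proof (rule ccontr)
    assume "\<not> p dvd (?q choose Suc j)"
    then have "coprime (p ^ k) (?q choose Suc j)" using p by (simp add: prime_imp_coprime coprime_power_left_iff)
    then have "p ^ k dvd Suc j" using dvd coprime_dvd_mult_left_iff by blast
    then show False using Suc.prems by (metis dvd_imp_le linorder_not_less zero_less_Suc)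
  qed
  moreover have "?q choose Suc j = ((?q - 1) choose j) + ((?q - 1) choose Suc j)"
    using q binomial_Suc_Suc[of "?q - 1" j] by simp
  ultimately show ?case using Suc by (metis Suc_lessD dvd_add_left_iff)
qed

text \<open>
  This follows from \<open>e (q choose e) = q (q - 1 choose e - 1)\<close> with \<open>q = p ^ k\<close>, as the last
  factor is coprime to \<open>p\<close>.
\<close>

lemma prime_power_dvd_choose_imp_dvd:
  fixes p :: nat
  assumes p: "prime p" and e: "0 < e" "e \<le> p ^ k" and dvd: "p ^ v dvd (p ^ k choose e)"
  shows "p ^ v dvd p ^ k"
proof -
  have q: "p ^ k > 0" using p by (simp add: prime_gt_0_nat)
  have "e * (p ^ k choose e) = p ^ k * ((p ^ k - 1) choose (e - 1))"
    using q e Suc_times_binomial_eq[of "p ^ k - 1" "e - 1"] by (simp add: mult.commute)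
  then have "p ^ v dvd p ^ k * ((p ^ k - 1) choose (e - 1))" using dvd by (metis dvd_mult)
  moreover have "\<not> p dvd ((p ^ k - 1) choose (e - 1))"
    using prime_not_dvd_choose_prime_power_minus_1[OF p, of "e - 1" k] e by simp
  then have "coprime (p ^ v) ((p ^ k - 1) choose (e - 1))" using p by (simp add: prime_imp_coprime coprime_power_left_iff)
  ultimately show ?thesis using coprime_dvd_mult_left_iff by blast
qed

lemma choose_2_le_choose:
  assumes "2 \<le> e" "e + 2 \<le> q"
  shows "q choose 2 \<le> q choose e"
proof (cases "2 * e \<le> q")
  case True
  then show ?thesis using binomial_mono[of 2 e q] assms by simp
next
  case False
  then have "2 * (q - e) \<le> q" "2 \<le> q - e" using assms by auto
  then have "q choose 2 \<le> q choose (q - e)" using binomial_mono[of 2 "q - e" q] by simp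
  then show ?thesis using assms binomial_symmetric[of e q] by simp
qed

text \<open>
  The \<open>p\<close>-part of \<open>p ^ k choose e\<close> is at most \<open>p ^ k\<close>, while the coefficient itself is at least
  \<open>p ^ k choose 2\<close>; so its \<open>p'\<close>-part, which divides \<open>m\<close>, is at least \<open>(p ^ k - 1) / 2\<close>.
\<close>

lemma choose_prime_power_dvd_bound:
  fixes p :: nat
  assumes p: "prime p" and e: "2 \<le> e" "e + 2 \<le> p ^ k" and m: "m > 0"
    and dvd: "(p ^ k choose e) dvd p ^ b * m"
  shows "p ^ k - 1 \<le> 2 * m"
proof -
  let ?q = "p ^ k" let ?x = "p ^ k choose e"
  have x: "?x > 0" using e by simp
  obtain v w where vw: "?x = p ^ v * w" "\<not> p dvd w"
    using multiplicity_decompose'[of ?x p] x p by (metis not_prime_unit not_gr_zero)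
  have "coprime w (p ^ b)" using p vw(2) by (simp add: prime_imp_coprime coprime_power_right_iff coprime_commute)
  moreover have "w dvd p ^ b * m" using dvd vw(1) dvd_mult_right by metis
  ultimately have "w dvd m" using coprime_dvd_mult_right_iff by blast
  then have "w \<le> m" using m by (simp add: dvd_imp_le)
  moreover have "p ^ v \<le> ?q"
    using prime_power_dvd_choose_imp_dvd[OF p, of e k v] e vw(1) p
    by (simp add: dvd_imp_le prime_gt_0_nat)
  ultimately have "?x \<le> ?q * m" using vw(1) by (simp add: mult_le_mono)
  then have "?q choose 2 \<le> ?q * m" using choose_2_le_choose[OF e] by simp
  moreover have "2 * (?q choose 2) = ?q * (?q - 1)"
  proof -
    have "even (r * (r - 1))" for r :: nat by (cases "even r") auto
    then show ?thesis unfolding choose_two by (rule dvd_mult_div_cancel)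
  qed
  ultimately have "?q * (?q - 1) \<le> ?q * (2 * m)" by linarith
  moreover have "0 < ?q" using e by linarith
  ultimately show ?thesis by (metis mult_le_cancel1)
qed

section \<open>The large orbit along an edge\<close>

text \<open>
  Here \<open>c\<close> is the number of spare points, which becomes a lower bound for a distance.  The two lower bounds on \<open>q\<close>
  serve the two directions along an edge: the quadratic one controls the possible orbit
  lengths in an overgroup, the factorial one excludes that an orbit of length \<open>q\<close> breaks into
  large pieces in a subgroup.
\<close>

locale large_orbit =
  fixes p k c n q :: nat
  assumes prime: "prime p" and q_def: "q = p ^ k" and n_def: "n = q + c" and c_pos: "0 < c"
    and q_gt_square: "(c + 1)\<^sup>2 < q - 1" and q_gt_fact: "4 * fact c < q - 1"
begin

definition big_orbit :: "(nat \<Rightarrow> nat) set \<Rightarrow> nat set \<Rightarrow> bool" where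
  "big_orbit C U \<longleftrightarrow> U \<subseteq> {1..n} \<and> (\<exists>y. U = perm_orbit C y) \<and> (card U = q - 1 \<or> card U = q)"

lemma q_gt: "c + 3 < q"
proof -
  have "(c + 1)\<^sup>2 = c * c + 2 * c + 1" by (simp add: power2_eq_square algebra_simps)
  moreover have "1 \<le> c * c" using c_pos by simp
  ultimately show ?thesis using q_gt_square c_pos by linarith
qed

text \<open>
  If \<open>t > q - 1\<close>, the \<open>p'\<close>-part \<open>u\<close> of \<open>t = p ^ j u\<close> divides both \<open>q - 1\<close> and
  \<open>t - (q - 1) \<le> c + 1\<close>, hence is small.  Either \<open>t\<close> is a multiple of \<open>q\<close> below \<open>2 q\<close>, or \<open>p ^ j\<close> divides
  \<open>t - q \<le> c\<close>; in the second case \<open>t = q\<close>, or else \<open>t \<le> c (c + 1)\<close> is too small.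
\<close>

lemma orbit_length_cases:
  assumes dvd: "t dvd p ^ a * (q - 1)" and t: "q - 1 \<le> t" "t \<le> q + c"
  shows "t = q - 1 \<or> t = q"
proof (rule ccontr)
  assume neg: "\<not> (t = q - 1 \<or> t = q)"
  then have tq: "q < t" using t by linarith
  then have "t \<noteq> 0" by simp
  then obtain j u where ju: "t = p ^ j * u" "\<not> p dvd u"
    using multiplicity_decompose'[of t p] prime by (metis not_prime_unit)
  have "coprime u (p ^ a)" using prime ju(2)
    by (simp add: prime_imp_coprime coprime_power_right_iff coprime_commute)
  moreover have "u dvd p ^ a * (q - 1)" using dvd ju(1) dvd_mult_right by metis
  ultimately have "u dvd q - 1" using coprime_dvd_mult_right_iff by blast
  then have "u dvd t - (q - 1)" using ju(1) by (simp add: dvd_diff_nat)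
  moreover have "0 < t - (q - 1)" "t - (q - 1) \<le> c + 1" using tq t by linarith+
  ultimately have u: "u \<le> c + 1" using dvd_imp_le by (metis le_trans)
  show False
  proof (cases "k \<le> j")
    case True
    then have "q dvd t" using ju(1) q_def by (simp add: le_imp_power_dvd)
    then have "q dvd t - q" using tq by (simp add: dvd_diff_nat)
    then show False using tq t q_gt by (auto dest: dvd_imp_le)
  next
    case False
    then have "p ^ j dvd t - q" using ju(1) q_def by (simp add: le_imp_power_dvd dvd_diff_nat)
    then have "p ^ j \<le> c" using tq t by (auto dest: dvd_imp_le)
    then have "t \<le> c * (c + 1)" unfolding ju(1) using u by (intro mult_le_mono)
    also have "\<dots> \<le> (c + 1)\<^sup>2" by (simp add: power2_eq_square)
    finally show False using q_gt_square tq by linarith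
  qed
qed

lemma orbit_length_prime_power:
  assumes dvd: "t dvd p ^ a * q" and t: "q \<le> t" "t \<le> q + c"
  shows "t = q"
proof -
  have "t dvd p ^ (a + k)" using dvd q_def by (simp add: power_add)
  then obtain j where j: "t = p ^ j" using divides_primepow_nat[OF prime] by blast
  have p2: "2 \<le> p" using prime by (rule prime_ge_2_nat)
  show ?thesis
  proof (rule ccontr)
    assume "t \<noteq> q"
    then have "p ^ k < p ^ j" using t(1) j q_def by simp
    then have "Suc k \<le> j" using p2 by (metis Suc_leI power_less_imp_less_exp prime prime_gt_1_nat)
    then have "p ^ Suc k \<le> p ^ j" using p2 by (intro power_increasing) auto
    moreover have "2 * p ^ k \<le> p ^ Suc k" using mult_le_mono1[OF p2, of "p ^ k"] by simp
    ultimately have "2 * q \<le> t" unfolding j q_def by linarith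
    then show False using t q_gt by linarith
  qed
qed

lemma finite_big_orbit: "big_orbit C U \<Longrightarrow> finite U"
  by (auto simp: big_orbit_def intro: finite_subset)

text \<open>Two disjoint big orbits would need \<open>2 (q - 1)\<close> points, more than there are.\<close>

lemma big_orbit_unique:
  assumes C: "subgroup C (sym_group n)" and U: "big_orbit C U" and V: "big_orbit C V"
  shows "U = V"
proof -
  obtain y z where yz: "U = perm_orbit C y" "V = perm_orbit C z"
    using U V by (auto simp: big_orbit_def)
  have "U \<inter> V \<noteq> {}"
  proof
    assume "U \<inter> V = {}"
    then have "card (U \<union> V) = card U + card V"
      using finite_big_orbit U V by (simp add: card_Un_disjoint)
    moreover have "U \<union> V \<subseteq> {1..n}" using U V by (auto simp: big_orbit_def)
    then have "card (U \<union> V) \<le> n" using card_mono[of "{1..n}" "U \<union> V"] by simp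
    moreover have "q - 1 \<le> card U" "q - 1 \<le> card V" using U V by (auto simp: big_orbit_def)
    ultimately show False using q_gt n_def by linarith
  qed
  then obtain x where "x \<in> U" "x \<in> V" by auto
  then show ?thesis using perm_orbit_eq[OF C] yz by metis
qed

lemma big_orbit_supergroup:
  assumes C: "subgroup C (sym_group n)" and E: "subgroup E (sym_group n)" and EC: "E \<subseteq> C"
    and card: "card C = p ^ a * card E" and U: "big_orbit E U"
  shows "\<exists>V. big_orbit C V \<and> U \<subseteq> V"
proof -
  obtain y where y: "U = perm_orbit E y" using U by (auto simp: big_orbit_def)
  have y1: "y \<in> {1..n}" using U perm_orbit_self[OF E, of y] unfolding y big_orbit_def by blast
  let ?V = "perm_orbit C y"
  have UV: "U \<subseteq> ?V" using y EC by auto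
  have Vn: "?V \<subseteq> {1..n}" by (rule perm_orbit_subset[OF C y1])
  then have "card ?V \<le> q + c" using card_mono[of "{1..n}" ?V] n_def by simp
  moreover have "card U \<le> card ?V" using card_mono UV finite_perm_orbit[OF C] by blast
  moreover have "card ?V dvd p ^ a * card U"
    using card_perm_orbit_dvd[OF C E EC card] y by simp
  ultimately have "card ?V = q - 1 \<or> card ?V = q"
    using U orbit_length_cases[of "card ?V" a] orbit_length_prime_power[of "card ?V" a]
    by (auto simp: big_orbit_def)
  then show ?thesis using UV Vn by (auto simp: big_orbit_def)
qed

text \<open>
  A group whose order is divisible by the \<open>p'\<close>-part of \<open>q!/2\<close> cannot split an invariant set of
  \<open>q\<close> points into invariant parts of sizes \<open>e\<close> and \<open>q - e\<close>, both at least two: its order would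
  divide \<open>e! (q - e)! c!\<close>, so the \<open>p'\<close>-part of \<open>q choose e\<close> would be at most \<open>2 c!\<close>.
\<close>

lemma invariant_subset_small:
  assumes E: "subgroup E (sym_group n)" and order: "fact q dvd 2 * p ^ b * card E"
    and U: "U \<subseteq> {1..n}" "card U = q" and T: "T \<subseteq> U"
    and invU: "\<And>f. f \<in> E \<Longrightarrow> f ` U \<subseteq> U" and invT: "\<And>f. f \<in> E \<Longrightarrow> f ` T \<subseteq> T"
  shows "card T \<le> 1 \<or> q - 1 \<le> card T"
proof (rule ccontr)
  assume "\<not> (card T \<le> 1 \<or> q - 1 \<le> card T)"
  then have e: "2 \<le> card T" "card T + 2 \<le> q" by auto
  let ?e = "card T"
  have "n - q = c" using n_def by simp
  then have "card E dvd fact ?e * fact (q - ?e) * fact c"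
    using card_dvd_of_invariant_subset[OF E U(1) T invU invT] U(2) by simp
  then have "2 * p ^ b * card E dvd 2 * p ^ b * (fact ?e * fact (q - ?e) * fact c)"
    by (intro mult_dvd_mono) auto
  then have "fact q dvd 2 * p ^ b * (fact ?e * fact (q - ?e) * fact c)"
    by (rule dvd_trans[OF order])
  moreover have "fact q = (fact ?e * fact (q - ?e)) * (q choose ?e)"
    using binomial_fact_lemma[of ?e q] e by (simp add: mult.assoc)
  moreover have "2 * p ^ b * (w * fact c) = w * (p ^ b * (2 * fact c))" for w
    by (simp only: mult.assoc mult.commute mult.left_commute)
  ultimately have "(fact ?e * fact (q - ?e)) * (q choose ?e) dvd
      (fact ?e * fact (q - ?e)) * (p ^ b * (2 * fact c))"
    by metis
  moreover have "(fact ?e * fact (q - ?e) :: nat) \<noteq> 0" by simp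
  ultimately have "(p ^ k choose ?e) dvd p ^ b * (2 * fact c)"
    unfolding q_def[symmetric] using dvd_times_left_cancel_iff by blast
  then have "p ^ k - 1 \<le> 2 * (2 * fact c)"
    using choose_prime_power_dvd_bound[OF prime, of ?e k "2 * fact c" b] e q_def by simp
  then show False using q_gt_fact q_def by simp
qed

text \<open>
  An orbit of length \<open>q - 1\<close> stays an orbit, because its length divides a power of \<open>p\<close> times the
  new length.  An orbit of length \<open>q\<close> can at most lose one fixed point.
\<close>

lemma big_orbit_subgroup:
  assumes C: "subgroup C (sym_group n)" and E: "subgroup E (sym_group n)" and EC: "E \<subseteq> C"
    and card: "card C = p ^ a * card E" and order: "fact q dvd 2 * p ^ b * card E"
    and U: "big_orbit C U"
  shows "\<exists>V. big_orbit E V \<and> V \<subseteq> U"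
proof -
  obtain y where y: "U = perm_orbit C y" using U by (auto simp: big_orbit_def)
  have Un: "U \<subseteq> {1..n}" using U by (simp add: big_orbit_def)
  have finU: "finite U" by (rule finite_big_orbit[OF U])
  have closed: "f x \<in> U" if "f \<in> E" "x \<in> U" for f x
    using perm_orbit_closed[OF C subsetD[OF EC that(1)]] that(2) unfolding y .
  then have orb: "perm_orbit E x \<subseteq> U" if "x \<in> U" for x
    using that by blast
  have orb_le: "card (perm_orbit E x) \<le> card U" if "x \<in> U" for x
    using card_mono[OF finU orb[OF that]] .
  show ?thesis
  proof (cases "card U = q")
    case False
    then have cU: "card U = q - 1" using U by (auto simp: big_orbit_def)
    have yU: "y \<in> U" using perm_orbit_self[OF C] y by simp
    have "coprime (q - 1) q" using coprime_diff_one_left_nat[of q] q_gt by simp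
    then have "coprime (q - 1) (p ^ a)"
      using q_def q_gt prime by (cases "k = 0") (auto simp: coprime_power_right_iff)
    moreover have "q - 1 dvd p ^ a * card (perm_orbit E y)"
      using card_perm_orbit_dvd[OF C E EC card, of y] y cU by simp
    ultimately have "q - 1 dvd card (perm_orbit E y)" using coprime_dvd_mult_right_iff by blast
    then have "q - 1 \<le> card (perm_orbit E y)" using dvd_imp_le card_perm_orbit_pos[OF E] by blast
    then have "card (perm_orbit E y) = q - 1" using orb_le[OF yU] cU by simp
    then show ?thesis using orb[OF yU] Un by (auto simp: big_orbit_def)
  next
    case True
    have invU: "f ` U \<subseteq> U" if "f \<in> E" for f using closed that by blast
    have inv: "f ` perm_orbit E x \<subseteq> perm_orbit E x" if "f \<in> E" for f x
      using perm_orbit_closed[OF E that] by auto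
    have sz: "card (perm_orbit E x) = 1 \<or> big_orbit E (perm_orbit E x)" if x: "x \<in> U" for x
    proof -
      have "card (perm_orbit E x) \<le> 1 \<or> q - 1 \<le> card (perm_orbit E x)"
        using invariant_subset_small[OF E order Un True orb[OF x] invU inv] by blast
      moreover have "card (perm_orbit E x) > 0" by (rule card_perm_orbit_pos[OF E])
      ultimately have "card (perm_orbit E x) = 1 \<or> card (perm_orbit E x) = q - 1 \<or> card (perm_orbit E x) = q"
        using orb_le[OF x] True by linarith
      then show ?thesis using orb[OF x] Un by (auto simp: big_orbit_def)
    qed
    have "\<not> U \<subseteq> {y}" using True q_gt card_mono[of "{y}" U] by auto
    then obtain z where z: "z \<in> U" "z \<noteq> y" by auto
    have yU: "y \<in> U" using perm_orbit_self[OF C] y by simp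
    (* two fixed points would form an invariant set with exactly two elements *)
    have "\<not> (card (perm_orbit E y) = 1 \<and> card (perm_orbit E z) = 1)"
    proof
      assume "card (perm_orbit E y) = 1 \<and> card (perm_orbit E z) = 1"
      then have "perm_orbit E y = {y}" "perm_orbit E z = {z}"
        using perm_orbit_self[OF E] by (metis card_1_singletonE singletonD)+
      then have "f ` {y, z} \<subseteq> {y, z}" if "f \<in> E" for f using that by blast
      then have "card {y, z} \<le> 1 \<or> q - 1 \<le> card {y, z}"
        using invariant_subset_small[OF E order Un True _ invU, of "{y, z}"] yU z by blast
      then show False using z q_gt by simp
    qed
    then show ?thesis using sz[OF yU] sz[OF z(1)] orb yU z(1) by blast
  qed
qed

text \<open>
  The state carried along a path: the large orbit, and enough of the order to exclude a
  splitting of that orbit.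
\<close>

definition good :: "(nat \<Rightarrow> nat) set \<Rightarrow> nat set \<Rightarrow> bool" where
  "good C U \<longleftrightarrow> subgroup C (sym_group n) \<and> big_orbit C U \<and> (\<exists>b. fact q dvd 2 * p ^ b * card C)"

lemma good_unique: "good C U \<Longrightarrow> good C V \<Longrightarrow> U = V"
  using big_orbit_unique by (auto simp: good_def)

text \<open>Both orbits contain the big orbit of the common subgroup.\<close>

lemma good_step:
  assumes C: "good C U" and C': "subgroup C' (sym_group n)"
    and E: "subgroup E (sym_group n)" "E \<subseteq> C" "E \<subseteq> C'"
    and card: "card C = p ^ a * card E" "card C' = p ^ a' * card E"
  shows "\<exists>V. good C' V \<and> card (U - V) \<le> 1"
proof -
  obtain b where sC: "subgroup C (sym_group n)" and U: "big_orbit C U"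
    and "fact q dvd 2 * p ^ b * card C" using C by (auto simp: good_def)
  then have order: "fact q dvd 2 * p ^ (b + a) * card E" using card by (simp add: power_add mult_ac)
  obtain W where W: "big_orbit E W" "W \<subseteq> U"
    using big_orbit_subgroup[OF sC E(1,2) card(1) order U] by auto
  obtain V where V: "big_orbit C' V" "W \<subseteq> V"
    using big_orbit_supergroup[OF C' E(1,3) card(2) W(1)] by auto
  have "fact q dvd 2 * p ^ (b + a) * card C'"
    using dvd_mult[OF order, of "p ^ a'"] card(2) by (simp add: mult_ac)
  then have "good C' V" using C' V by (auto simp: good_def)
  moreover have "card (U - V) \<le> card (U - W)"
    using V(2) finite_big_orbit[OF U] by (intro card_mono) auto
  moreover have "card (U - W) = card U - card W"
    using W finite_big_orbit by (simp add: card_Diff_subset)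
  moreover have "card U \<le> q" "q - 1 \<le> card W" using U W by (auto simp: big_orbit_def)
  ultimately show ?thesis by (intro exI[of _ V]) linarith
qed

end

section \<open>Homomorphisms out of free groups\<close>

context group
begin

lemma word_val_Nil: "word_val G [] = \<one>"
  and word_val_Cons: "word_val G (l # w) = letter_val G l \<otimes> word_val G w"
  by (simp_all add: word_val_def)

lemma letter_val_closed: "fst l \<in> carrier G \<Longrightarrow> letter_val G l \<in> carrier G"
  by (simp add: letter_val_def)

lemma word_val_closed: "fst ` set w \<subseteq> carrier G \<Longrightarrow> word_val G w \<in> carrier G"
  by (induction w) (auto simp: word_val_Nil word_val_Cons letter_val_closed)

lemma word_val_append:
  assumes "fst ` set u \<subseteq> carrier G" "fst ` set v \<subseteq> carrier G"
  shows "word_val G (u @ v) = word_val G u \<otimes> word_val G v"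
  using assms
  by (induction u) (auto simp: word_val_Nil word_val_Cons letter_val_closed word_val_closed m_assoc)

lemma word_val_cancel:
  assumes "fst ` set (u @ l # m # v) \<subseteq> carrier G" and "fst l = fst m" "snd l \<noteq> snd m"
  shows "word_val G (u @ l # m # v) = word_val G (u @ v)"
proof -
  have "letter_val G l \<otimes> letter_val G m = \<one>"
    using assms by (cases "snd l") (auto simp: letter_val_def)
  moreover have "letter_val G l \<in> carrier G" "letter_val G m \<in> carrier G"
    using assms by (auto simp: letter_val_closed)
  moreover have "fst ` set v \<subseteq> carrier G" using assms by auto
  then have "word_val G v \<in> carrier G" by (rule word_val_closed)
  ultimately have "word_val G (l # m # v) = word_val G v"
    by (simp add: word_val_Cons m_assoc[symmetric])
  then show ?thesis using assms word_val_append[of u "l # m # v"] word_val_append[of u v]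
    by (simp add: image_Un)
qed

end

lemma not_successivelyE:
  assumes "\<not> successively P w"
  obtains u l m v where "w = u @ l # m # v" "\<not> P l m"
proof -
  have "\<exists>u l m v. w = u @ l # m # v \<and> \<not> P l m"
    using assms
  proof (induction w rule: induct_list012)
    case (3 x y zs)
    show ?case
    proof (cases "P x y")
      case True
      then have "\<not> successively P (y # zs)" using 3 by simp
      then obtain u l m v where "y # zs = u @ l # m # v" "\<not> P l m" using 3 by blast
      then show ?thesis by (intro exI[of _ "x # u"]) auto
    next
      case False
      then show ?thesis by (intro exI[of _ "[]"]) auto
    qed
  qed auto
  then show ?thesis using that by blast
qed

text \<open>
  Cancelling an adjacent inverse pair is legitimate in every group at once, so a word and its
  reduced form have the same value under every assignment of the letters.
\<close>

lemma reduced_word_exists: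
  assumes F: "group F" "S \<subseteq> carrier F" and T: "group T" "f \<in> S \<rightarrow> carrier T"
    and w: "w \<in> lists (S \<times> UNIV)"
  shows "\<exists>w'\<in>lists (S \<times> UNIV). reduced_word w' \<and> word_val F w' = word_val F w \<and>
    word_val T (map (map_prod f id) w') = word_val T (map (map_prod f id) w)"
  using w
proof (induction "length w" arbitrary: w rule: less_induct)
  case less
  show ?case
  proof (cases "reduced_word w")
    case True
    then show ?thesis using less by blast
  next
    case False
    then obtain u l m v where w: "w = u @ l # m # v" and lm: "fst l = fst m" "snd l \<noteq> snd m"
      unfolding reduced_word_def by (elim not_successivelyE) auto
    have fs: "fst ` set w \<subseteq> S" using less.prems by auto
    then have "word_val F w = word_val F (u @ v)"
      using F unfolding w by (intro group.word_val_cancel lm) auto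
    moreover have "word_val T (map (map_prod f id) w) = word_val T (map (map_prod f id) (u @ v))"
    proof -
      have "f (fst l) \<in> carrier T" if "l \<in> set w" for l using that fs T(2) by blast
      then have "fst ` set (map (map_prod f id) w) \<subseteq> carrier T" by fastforce
      then show ?thesis
        using group.word_val_cancel[OF T(1), of "map (map_prod f id) u" "map_prod f id l"
            "map_prod f id m" "map (map_prod f id) v"] lm unfolding w by simp
    qed
    moreover have "u @ v \<in> lists (S \<times> UNIV)" "length (u @ v) < length w"
      using less.prems unfolding w by auto
    ultimately show ?thesis using less.hyps[of "u @ v"] by metis
  qed
qed

lemma free_basis_extend_hom:
  assumes F: "group F" "free_basis F S" and T: "group T" "f \<in> S \<rightarrow> carrier T"
  obtains h where "h \<in> hom F T" "\<And>s. s \<in> S \<Longrightarrow> h s = f s"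
proof -
  interpret F: group F by fact
  interpret T: group T by fact
  let ?W = "{w \<in> lists (S \<times> UNIV). reduced_word w}"
  have S: "S \<subseteq> carrier F" and bij: "bij_betw (word_val F) ?W (carrier F)"
    using F(2) by (auto simp: free_basis_def)
  define e where "e w = word_val T (map (map_prod f id) w)" for w
  define h where "h x = e (inv_into ?W (word_val F) x)" for x
  have h_word: "h (word_val F w) = e w" if w: "w \<in> lists (S \<times> UNIV)" for w
  proof -
    obtain w' where w': "w' \<in> ?W" "word_val F w' = word_val F w" "e w' = e w"
      using reduced_word_exists[OF F(1) S T w] by (auto simp: e_def)
    have "inv_into ?W (word_val F) (word_val F w') = w'"
      using bij w'(1) by (simp add: bij_betw_def inv_into_f_f)
    then show ?thesis using w' by (simp add: h_def)
  qed
  have word: "\<exists>w\<in>lists (S \<times> UNIV). x = word_val F w" if "x \<in> carrier F" for x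
    using that bij by (auto simp: bij_betw_def)
  have cF: "fst ` set w \<subseteq> carrier F" and cT: "fst ` set (map (map_prod f id) w) \<subseteq> carrier T"
    if "w \<in> lists (S \<times> UNIV)" for w
    using that S T(2) by auto
  have "h \<in> hom F T"
  proof (rule homI)
    fix x assume "x \<in> carrier F"
    then obtain w where w: "w \<in> lists (S \<times> UNIV)" "x = word_val F w" using word by blast
    then show "h x \<in> carrier T" using T.word_val_closed[OF cT[OF w(1)]] h_word by (simp add: e_def)
    fix y assume "y \<in> carrier F"
    then obtain v where v: "v \<in> lists (S \<times> UNIV)" "y = word_val F v" using word by blast
    have "x \<otimes>\<^bsub>F\<^esub> y = word_val F (w @ v)" 
      unfolding w(2) v(2) by (rule F.word_val_append[OF cF[OF w(1)] cF[OF v(1)], symmetric])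
    then have "h (x \<otimes>\<^bsub>F\<^esub> y) = e (w @ v)" using h_word[of "w @ v"] w v by simp
    also have "\<dots> = e w \<otimes>\<^bsub>T\<^esub> e v"
      unfolding e_def map_append by (rule T.word_val_append[OF cT[OF w(1)] cT[OF v(1)]])
    finally show "h (x \<otimes>\<^bsub>F\<^esub> y) = h x \<otimes>\<^bsub>T\<^esub> h y" using h_word w v by simp
  qed
  moreover have "h s = f s" if s: "s \<in> S" for s
  proof -
    have "word_val F [(s, True)] = s" using s S by (auto simp: word_val_def letter_val_def)
    moreover have "f s \<in> carrier T" using s T(2) by auto
    then have "e [(s, True)] = f s" by (simp add: e_def word_val_def letter_val_def)
    ultimately show ?thesis using h_word[of "[(s, True)]"] s by simp
  qed
  ultimately show ?thesis using that by blast
qed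

text \<open>With at most one basis element, every word evaluates to a power of it.\<close>

lemma free_basis_two_elements:
  assumes F: "group F" "free_basis F S" and nc: "\<not> cyclic_group F"
  obtains s t where "s \<in> S" "t \<in> S" "s \<noteq> t"
proof (cases "\<exists>s\<in>S. \<exists>t\<in>S. s \<noteq> t")
  case True
  then show ?thesis using that by blast
next
  case False
  interpret F: group F by fact
  have S: "S \<subseteq> carrier F" and bij: "bij_betw (word_val F) {w \<in> lists (S \<times> UNIV). reduced_word w} (carrier F)"
    using F(2) by (auto simp: free_basis_def)
  obtain x where x: "x \<in> carrier F" "S \<subseteq> {x}"
  proof (cases "S = {}")
    case True
    then show ?thesis using that[of "\<one>\<^bsub>F\<^esub>"] by simp
  next
    case nonempty: False
    then obtain s where "s \<in> S" by auto
    then show ?thesis using that[of s] False S by auto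
  qed
  have pow: "\<exists>n::int. word_val F w = x [^]\<^bsub>F\<^esub> n" if "w \<in> lists (S \<times> UNIV)" for w
    using that
  proof (induction w)
    case Nil
    then show ?case by (intro exI[of _ 0]) (simp add: F.word_val_Nil)
  next
    case (Cons l w)
    then obtain n :: int where n: "word_val F w = x [^]\<^bsub>F\<^esub> n" by auto
    have "fst l = x" using Cons x by auto
    then have "letter_val F l = x [^]\<^bsub>F\<^esub> (if snd l then 1 else - 1 :: int)"
      using x by (auto simp: letter_val_def F.int_pow_neg)
    then have "word_val F (l # w) = x [^]\<^bsub>F\<^esub> ((if snd l then 1 else - 1) + n)"
      using n x by (simp only: F.word_val_Cons F.int_pow_mult)
    then show ?case by blast
  qed
  have "carrier F = range (\<lambda>n::int. x [^]\<^bsub>F\<^esub> n)"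
  proof
    show "carrier F \<subseteq> range (\<lambda>n::int. x [^]\<^bsub>F\<^esub> n)"
      using bij pow by (fastforce simp: bij_betw_def)
  qed (use x in auto)
  then have "cyclic_group F" using x F.cyclic_group by blast
  then show ?thesis using nc by simp
qed

section \<open>Generating the symmetric group\<close>

lemma conj_transpose:
  assumes "bij f"
  shows "f \<circ> Transposition.transpose a b \<circ> inv' f = Transposition.transpose (f a) (f b)"
proof -
  have "Transposition.transpose (f a) (f b) \<circ> f = f \<circ> Transposition.transpose a b"
    using transpose_comp_eq[OF assms, of "f a" "f b"] assms by (simp add: bij_is_inj)
  then have "f \<circ> Transposition.transpose a b \<circ> inv' f = Transposition.transpose (f a) (f b) \<circ> (f \<circ> inv' f)"
    by (simp add: comp_assoc[symmetric])
  also have "f \<circ> inv' f = id" using bij_is_surj[OF assms] by (simp only: surj_iff)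
  finally show ?thesis by (simp only: comp_id)
qed

text \<open>
  Conjugation by the cycle turns \<open>(i i+1)\<close> into \<open>(i+1 i+2)\<close>, and neighbouring transpositions
  give all \<open>(1 i)\<close>, then all \<open>(a b)\<close>.
\<close>

lemma transposition_cycle_generate_sym_group:
  assumes C: "subgroup C (sym_group n)" and n: "2 \<le> n"
    and t: "Transposition.transpose 1 2 \<in> C"
    and g: "g \<in> C" "\<And>i. 1 \<le> i \<Longrightarrow> i < n \<Longrightarrow> g i = Suc i"
  shows "C = carrier (sym_group n)"
proof
  note D = subgroup_sym_groupD[OF C]
  show "C \<subseteq> carrier (sym_group n)" using D(4) by (auto simp: sym_group_carrier)
  have adj: "Transposition.transpose i (Suc i) \<in> C" if "1 \<le> i" "i < n" for i
    using that
  proof (induction i rule: nat_induct_at_least)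
    case base
    then show ?case using t by (simp add: numeral_2_eq_2)
  next
    case (Suc i)
    then have "Transposition.transpose i (Suc i) \<in> C" by simp
    then have "g \<circ> Transposition.transpose i (Suc i) \<circ> inv' g \<in> C" using D(2,3) g(1) by blast
    moreover have "bij g" using D(4)[OF g(1)] by (rule permutes_bij)
    moreover have "g i = Suc i" "g (Suc i) = Suc (Suc i)" using g(2) Suc by auto
    ultimately show ?case by (simp add: conj_transpose)
  qed
  have one: "Transposition.transpose 1 i \<in> C" if "2 \<le> i" "i \<le> n" for i
    using that
  proof (induction i rule: nat_induct_at_least)
    case base
    then show ?case using t by simp
  next
    case (Suc i)
    then have "Transposition.transpose 1 i \<in> C" "Transposition.transpose i (Suc i) \<in> C"
      using adj[of i] by auto
    then have "Transposition.transpose 1 i \<circ> Transposition.transpose i (Suc i) \<circ> Transposition.transpose 1 i \<in> C"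
      using D(2) by blast
    then show ?case using Suc transpose_comp_triple[of 1 "Suc i" i] by simp
  qed
  have tr: "Transposition.transpose a b \<in> C" if ab: "a \<in> {1..n}" "b \<in> {1..n}" "a \<noteq> b" for a b
  proof (cases "a = 1 \<or> b = 1")
    case True
    then show ?thesis using one ab by (auto simp: transpose_commute)
  next
    case False
    then have "Transposition.transpose 1 a \<in> C" "Transposition.transpose 1 b \<in> C" using one ab by auto
    then have "Transposition.transpose a 1 \<circ> Transposition.transpose 1 b \<circ> Transposition.transpose a 1 \<in> C"
      using D(2) by (metis transpose_commute)
    then show ?thesis using transpose_comp_triple[of a b 1] False ab by simp
  qed
  show "carrier (sym_group n) \<subseteq> C"
  proof
    fix f assume "f \<in> carrier (sym_group n)"
    then have "f permutes {1..n}" "finite {1..n}" by (simp_all add: sym_group_carrier)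
    then show "f \<in> C"
    proof (induction rule: permutes_induct)
      case id
      then show ?case by (rule D(1))
    next
      case (swap a b p)
      then show ?case using D(2) tr by blast
    qed
  qed
qed

lemma free_group_surj_sym_group:
  assumes F: "free_group F" "\<not> cyclic_group F" and n: "2 \<le> n"
  obtains h where "h \<in> hom F (sym_group n)" "h ` carrier F = carrier (sym_group n)"
proof -
  interpret F: group F using F by (simp add: free_group_def)
  interpret S: group "sym_group n" by (rule sym_group_is_group)
  obtain B where B: "free_basis F B" using F by (auto simp: free_group_def)
  obtain s t where st: "s \<in> B" "t \<in> B" "s \<noteq> t"
    using free_basis_two_elements[OF F.group_axioms B F(2)] .
  define c where "c i = (if i \<in> {1..n} then if i = n then 1 else Suc i else i)" for i
  have c: "c permutes {1..n}"
  proof (rule bij_imp_permutes)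
    have "inj_on c {1..n}" by (auto simp: inj_on_def c_def split: if_splits)
    moreover have "c ` {1..n} \<subseteq> {1..n}" by (auto simp: c_def)
    ultimately show "bij_betw c {1..n} {1..n}" by (simp add: bij_betw_def endo_inj_surj)
  qed (auto simp: c_def)
  define f where "f x = (if x = s then Transposition.transpose 1 2 else c)" for x
  have "Transposition.transpose 1 2 permutes {1..n}" using n by (intro permutes_swap_id) auto
  then have "f \<in> B \<rightarrow> carrier (sym_group n)" using c by (auto simp: f_def sym_group_carrier)
  then obtain h where h: "h \<in> hom F (sym_group n)" "\<And>x. x \<in> B \<Longrightarrow> h x = f x"
    using free_basis_extend_hom[OF F.group_axioms B S.group_axioms] by blast
  interpret h: group_hom F "sym_group n" h using h(1) by unfold_locales
  have BF: "B \<subseteq> carrier F" using B by (simp add: free_basis_def)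
  have "h s \<in> h ` carrier F" "h t \<in> h ` carrier F" using st BF by auto
  moreover have "h s = Transposition.transpose 1 2" "h t = c" using st h(2) by (auto simp: f_def)
  ultimately have "Transposition.transpose 1 2 \<in> h ` carrier F" "c \<in> h ` carrier F" by metis+
  then have "h ` carrier F = carrier (sym_group n)"
    by (rule transposition_cycle_generate_sym_group[OF h.img_is_subgroup n]) (simp add: c_def)
  then show ?thesis using that h(1) by blast
qed

lemma permutation_of_triples:
  assumes "a \<in> S" "b \<in> S" "c \<in> S" "a \<noteq> b" "a \<noteq> c" "b \<noteq> c"
    and "x \<in> S" "y \<in> S" "z \<in> S" "x \<noteq> y" "x \<noteq> z" "y \<noteq> z"
  obtains f where "f permutes S" "f a = x" "f b = y" "f c = z"
proof -
  define t1 where "t1 = Transposition.transpose a x"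
  have p1: "t1 permutes S" unfolding t1_def using assms by (intro permutes_swap_id) auto
  have t1a: "t1 a = x" by (simp add: t1_def)
  have i1: "t1 u = t1 v \<longleftrightarrow> u = v" for u v using permutes_inj[OF p1] by (auto dest: injD)
  have b1: "t1 b \<in> S" "t1 b \<noteq> x" using permutes_in_image[OF p1] assms i1 t1a by metis+
  define t2 where "t2 = Transposition.transpose (t1 b) y"
  have p2: "t2 permutes S" unfolding t2_def using assms b1 by (intro permutes_swap_id) auto
  have t2: "t2 x = x" "t2 (t1 b) = y" using b1 assms by (auto simp: t2_def transpose_def)
  have i2: "t2 u = t2 v \<longleftrightarrow> u = v" for u v using permutes_inj[OF p2] by (auto dest: injD)
  have c2: "t2 (t1 c) \<in> S" "t2 (t1 c) \<noteq> x" "t2 (t1 c) \<noteq> y"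
    using permutes_in_image[OF p1] permutes_in_image[OF p2] assms i1 i2 t1a t2 by metis+
  define t3 where "t3 = Transposition.transpose (t2 (t1 c)) z"
  have p3: "t3 permutes S" unfolding t3_def using assms c2 by (intro permutes_swap_id) auto
  have t3: "t3 x = x" "t3 y = y" "t3 (t2 (t1 c)) = z"
    using c2 assms by (auto simp: t3_def transpose_def)
  have "t3 \<circ> t2 \<circ> t1 permutes S" using p1 p2 p3 by (intro permutes_compose)
  then show ?thesis using that[of "t3 \<circ> t2 \<circ> t1"] t1a t2 t3 by simp
qed

text \<open>
  Preimages of the \<open>n - 1\<close> transpositions \<open>(1 i)\<close> outnumber the cosets of \<open>N\<close>.  Two of them in
  one coset have a quotient in \<open>N\<close> that maps to a \<open>3\<close>-cycle, and conjugation yields all others.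
\<close>

lemma (in group) three_cycles_in_image_of_normal:
  assumes H: "subgroup H G" and N: "N \<lhd> G" "N \<subseteq> H" "finite (rcosets N)"
    and n: "card (rcosets N) + 1 < n"
    and h: "h \<in> hom (G\<lparr>carrier := H\<rparr>) (sym_group n)" "h ` H = carrier (sym_group n)"
    and xyz: "x \<in> {1..n}" "y \<in> {1..n}" "z \<in> {1..n}" "x \<noteq> y" "x \<noteq> z" "y \<noteq> z"
  shows "Transposition.transpose x y \<circ> Transposition.transpose x z \<in> h ` N"
proof -
  interpret H: subgroup H G by fact
  interpret N: normal N G by fact
  interpret GH: group "G\<lparr>carrier := H\<rparr>" using H.subgroup_is_group group_axioms by blast
  interpret S: group "sym_group n" by (rule sym_group_is_group)
  interpret h: group_hom "G\<lparr>carrier := H\<rparr>" "sym_group n" h using h(1) by unfold_locales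
  have hm: "h (a \<otimes> b) = h a \<circ> h b" if "a \<in> H" "b \<in> H" for a b
    using h.hom_mult[of a b] that by (simp add: sym_group_mult)
  have hi: "h (inv a) = inv' (h a)" if "a \<in> H" for a
    using h.hom_inv[of a] that H m_inv_consistent h.hom_closed[of a] by simp
  have conj: "f \<circ> g \<circ> inv' f \<in> h ` N" if f: "f permutes {1..n}" and g: "g \<in> h ` N" for f g
  proof -
    obtain a where a: "a \<in> H" "f = h a" 
      using f h(2) sym_group_carrier[of f n] by (metis imageE)
    obtain b where b: "b \<in> N" "g = h b" using g by auto
    have "b \<in> H" "inv a \<in> H" using a b N(2) by auto
    then have "f \<circ> g \<circ> inv' f = h (a \<otimes> b \<otimes> inv a)" using a b hm hi by simp
    moreover have "a \<otimes> b \<otimes> inv a \<in> N" using a b N.inv_op_closed2 by auto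
    ultimately show ?thesis by auto
  qed
  have "\<exists>a\<in>H. h a = Transposition.transpose 1 i" if "i \<in> {2..n}" for i
  proof -
    have "Transposition.transpose 1 i permutes {1..n}" using that by (intro permutes_swap_id) auto
    then have "Transposition.transpose 1 i \<in> h ` H" using h(2) by (simp add: sym_group_carrier)
    then show ?thesis by (metis imageE)
  qed
  then obtain a where a: "\<And>i. i \<in> {2..n} \<Longrightarrow> a i \<in> H \<and> h (a i) = Transposition.transpose 1 i"
    by metis
  have "\<not> inj_on (\<lambda>i. N #> a i) {2..n}"
  proof (rule pigeonhole)
    have "(\<lambda>i. N #> a i) ` {2..n} \<subseteq> rcosets N" using a by (auto simp: rcosets_image)
    then have "card ((\<lambda>i. N #> a i) ` {2..n}) \<le> card (rcosets N)" using N(3) card_mono by blast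
    then show "card ((\<lambda>i. N #> a i) ` {2..n}) < card {2..n}" using n by simp
  qed
  then obtain i j where ij: "i \<in> {2..n}" "j \<in> {2..n}" "i \<noteq> j" "N #> a i = N #> a j"
    by (auto simp: inj_on_def)
  have "a i \<otimes> inv (a j) \<in> N" using ij a r_coset_eq_iff[OF N.is_subgroup, of "a i" "a j"] by auto
  moreover have "h (a i \<otimes> inv (a j)) = Transposition.transpose 1 i \<circ> Transposition.transpose 1 j"
    using a[OF ij(1)] a[OF ij(2)] hm hi by simp
  ultimately have 1: "Transposition.transpose 1 i \<circ> Transposition.transpose 1 j \<in> h ` N"
    by (metis image_eqI)
  obtain f where f: "f permutes {1..n}" "f 1 = x" "f i = y" "f j = z"
    using permutation_of_triples[of 1 "{1..n}" i j x y z] ij xyz n by auto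
  have "f \<circ> (Transposition.transpose 1 i \<circ> Transposition.transpose 1 j) \<circ> inv' f =
    (f \<circ> Transposition.transpose 1 i \<circ> inv' f) \<circ> (f \<circ> Transposition.transpose 1 j \<circ> inv' f)"
    using permutes_inverses[OF f(1)] by (auto simp: fun_eq_iff)
  also have "\<dots> = Transposition.transpose x y \<circ> Transposition.transpose x z"
    using conj_transpose[OF permutes_bij[OF f(1)]] f by simp
  finally show ?thesis using conj[OF f(1) 1] by simp
qed

section \<open>Long geodesics from a permutation representation\<close>

locale permutation_representation = group G + large_orbit p k c n q
  for G (structure) and p k c n q :: nat +
  fixes N and \<rho> :: "'a \<Rightarrow> nat \<Rightarrow> nat"
  assumes N_normal: "N \<lhd> G" and N_finite_index: "finite_index G N"
    and \<rho>_hom: "\<rho> \<in> hom (G\<lparr>carrier := N\<rparr>) (sym_group n)"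
    and three_cycles: "x \<in> {1..n} \<Longrightarrow> y \<in> {1..n} \<Longrightarrow> z \<in> {1..n} \<Longrightarrow>
      x \<noteq> y \<Longrightarrow> x \<noteq> z \<Longrightarrow> y \<noteq> z \<Longrightarrow>
      Transposition.transpose x y \<circ> Transposition.transpose x z \<in> \<rho> ` N"
begin

abbreviation \<Gamma> where "\<Gamma> \<equiv> with_proj (local_commens_graph G p)"

definition supported :: "nat set \<Rightarrow> 'a set" where
  "supported S = {a \<in> N. \<forall>x. x \<notin> S \<longrightarrow> \<rho> a x = x}"

lemma N_subgroup: "subgroup N G"
  using N_normal by (rule normal_imp_subgroup)

lemma N_group: "group (G\<lparr>carrier := N\<rparr>)"
  using N_subgroup by (rule subgroup_imp_group)

lemma \<rho>_group_hom: "group_hom (G\<lparr>carrier := N\<rparr>) (sym_group n) \<rho>"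
  using N_group sym_group_is_group \<rho>_hom by (simp add: group_hom_def group_hom_axioms_def)

lemma \<rho>_permutes: "a \<in> N \<Longrightarrow> \<rho> a permutes {1..n}"
  using group_hom.hom_closed[OF \<rho>_group_hom, of a] by (simp add: sym_group_carrier)

lemma \<rho>_mult: "a \<in> N \<Longrightarrow> b \<in> N \<Longrightarrow> \<rho> (a \<otimes> b) = \<rho> a \<circ> \<rho> b"
  using group_hom.hom_mult[OF \<rho>_group_hom, of a b] by (simp add: sym_group_mult)

lemma \<rho>_one: "\<rho> \<one> = id"
  using group_hom.hom_one[OF \<rho>_group_hom] by (simp add: sym_group_one)

lemma \<rho>_inv: "a \<in> N \<Longrightarrow> \<rho> (inv a) = inv' (\<rho> a)"
  using group_hom.hom_inv[OF \<rho>_group_hom, of a] N_subgroup m_inv_consistent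
    group_hom.hom_closed[OF \<rho>_group_hom, of a] by simp

lemma image_subgroup:
  assumes "subgroup X G" "X \<subseteq> N"
  shows "subgroup (\<rho> ` X) (sym_group n)"
  using group_hom.subgroup_img_is_subgroup[OF \<rho>_group_hom]
    subgroup_incl[OF assms(1) N_subgroup assms(2)] by blast

lemma hom_restrict: "X \<subseteq> N \<Longrightarrow> \<rho> \<in> hom (G\<lparr>carrier := X\<rparr>) (sym_group n)"
  using \<rho>_hom by (auto simp: hom_def)

lemma supported_subset: "supported S \<subseteq> N"
  by (auto simp: supported_def)

lemma supported_mono: "S \<subseteq> T \<Longrightarrow> supported S \<subseteq> supported T"
  by (auto simp: supported_def)

lemma supported_subgroup: "subgroup (supported S) G"
proof (rule subgroupI)
  note N = subgroup.mem_carrier[OF N_subgroup] subgroup.one_closed[OF N_subgroup]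
    subgroup.m_closed[OF N_subgroup] subgroup.m_inv_closed[OF N_subgroup]
  show "supported S \<subseteq> carrier G" using N by (auto simp: supported_def)
  have "\<one> \<in> supported S" using N by (simp add: supported_def \<rho>_one)
  then show "supported S \<noteq> {}" by blast
  fix a assume a: "a \<in> supported S"
  then show "inv a \<in> supported S"
    using N permutes_inv_eq[OF \<rho>_permutes, of a] by (simp add: supported_def \<rho>_inv)
  fix b assume "b \<in> supported S"
  with a show "a \<otimes> b \<in> supported S" using N by (simp add: supported_def \<rho>_mult)
qed

lemma supported_permutes: "a \<in> supported S \<Longrightarrow> \<rho> a permutes S"
  using permutes_bij[OF \<rho>_permutes[of a]] unfolding supported_def
  by (auto intro!: permutes_superset[of _ UNIV] simp: permutes_def bij_iff)

text \<open>Any \<open>x\<close> and \<open>y\<close> in \<open>S\<close> lie on a \<open>3\<close>-cycle with a further point of \<open>S\<close>.\<close>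

lemma supported_orbit:
  assumes S: "S \<subseteq> {1..n}" "3 \<le> card S" and x: "x \<in> S"
  shows "perm_orbit (\<rho> ` supported S) x = S"
proof
  show "perm_orbit (\<rho> ` supported S) x \<subseteq> S"
    using permutes_in_image[OF supported_permutes] x by auto
  show "S \<subseteq> perm_orbit (\<rho> ` supported S) x"
  proof
    fix y assume y: "y \<in> S"
    show "y \<in> perm_orbit (\<rho> ` supported S) x"
    proof (cases "y = x")
      case True
      have "\<rho> \<one> x = x" by (simp add: \<rho>_one)
      then show ?thesis
        using True subgroup.one_closed[OF supported_subgroup, of S] by (metis image_eqI)
    next
      case False
      have "card {x, y} < card S" using S(2) False by simp
      then have "\<not> S \<subseteq> {x, y}" using card_mono[of "{x, y}" S] by auto
      then obtain z where z: "z \<in> S" "z \<noteq> x" "z \<noteq> y" by auto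
      let ?f = "Transposition.transpose y x \<circ> Transposition.transpose y z"
      have "?f \<in> \<rho> ` N" using three_cycles[of y x z] x y z False S(1) by blast
      then obtain a where a: "a \<in> N" "\<rho> a = ?f" by (metis imageE)
      have "a \<in> supported S" using a x y z by (auto simp: supported_def transpose_def)
      moreover have "\<rho> a x = y" using a False z by (auto simp: transpose_def)
      ultimately show ?thesis by (metis image_eqI)
    qed
  qed
qed

lemma supported_stabilizer:
  "x \<notin> S \<Longrightarrow> {a \<in> supported (insert x S). \<rho> a x = x} = supported S"
  by (auto simp: supported_def)

lemma index_supported:
  assumes S: "insert x S \<subseteq> {1..n}" "x \<notin> S" "2 \<le> card S"
  shows "index_in G (supported (insert x S)) (supported S) = Suc (card S)"
proof -
  have fin: "finite S" using finite_subset[OF S(1)] by simp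
  have "perm_orbit (\<rho> ` supported (insert x S)) x = insert x S"
    using supported_orbit[of "insert x S" x] S fin by simp
  moreover have "index_in G (supported (insert x S)) {a \<in> supported (insert x S). \<rho> a x = x} =
      card (perm_orbit (\<rho> ` supported (insert x S)) x)"
    by (rule index_in_stabilizer(2)[OF supported_subgroup hom_restrict[OF supported_subset]])
  moreover note supported_stabilizer[OF S(2)]
  moreover have "card (insert x S) = Suc (card S)" using S(2) fin by simp
  ultimately show ?thesis by metis
qed

lemma finite_index_supported: "finite_index G (supported S)"
proof (rule finite_index_tower[OF N_finite_index supported_subgroup supported_subset])
  have N: "N \<subseteq> carrier G" using N_subgroup by (rule subgroup.subset)
  define f where "f a = (\<lambda>x. if x \<notin> S then inv' (\<rho> a) x else x)" for a
  have "finite (rcosets\<^bsub>G\<lparr>carrier := N\<rparr>\<^esub> supported S) \<longleftrightarrow> finite (f ` N)"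
  proof (rule index_in_eq_card_image(2)[OF supported_subgroup N])
    fix a b assume ab: "a \<in> N" "b \<in> N"
    have "f a = f b \<longleftrightarrow> (\<forall>x. x \<notin> S \<longrightarrow> inv' (\<rho> a) x = inv' (\<rho> b) x)"
      by (auto simp: f_def fun_eq_iff)
    also have "\<dots> \<longleftrightarrow> (\<forall>x. x \<notin> S \<longrightarrow> \<rho> a (inv' (\<rho> b) x) = x)"
      using permutes_inv_eq[OF \<rho>_permutes[OF ab(1)]] by metis
    finally show "f a = f b \<longleftrightarrow> a \<otimes> inv b \<in> supported S"
      using ab subgroup.m_closed[OF N_subgroup] subgroup.m_inv_closed[OF N_subgroup]
      by (simp add: supported_def \<rho>_mult \<rho>_inv)
  qed
  moreover have "f ` N \<subseteq> (\<lambda>g x. if x \<notin> S then g x else x) ` {g. g permutes {1..n}}"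
    using permutes_inv[OF \<rho>_permutes] by (auto simp: f_def)
  then have "finite (f ` N)" by (rule finite_subset) (simp add: finite_permutations)
  ultimately show "finite (rcosets\<^bsub>G\<lparr>carrier := N\<rparr>\<^esub> supported S)" by simp
qed

text \<open>
  By orbits and stabilizers, adding a point to \<open>S\<close> multiplies the order by the new size of \<open>S\<close>.
  This starts at two points, where the \<open>3\<close>-cycles say nothing; hence the factor \<open>2\<close>.
\<close>

lemma fact_dvd_card_image_supported:
  assumes "S \<subseteq> {1..n}" "2 \<le> card S"
  shows "fact (card S) dvd 2 * card (\<rho> ` supported S)"
proof -
  have "finite S" using finite_subset[OF assms(1)] by simp
  then show ?thesis using assms
  proof (induction S rule: finite_induct)
    case (insert x S)
    show ?case
    proof (cases "card S = 1")
      case True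
      then have "card (insert x S) = 2" using insert.hyps by simp
      then show ?thesis by (simp only: fact_2 dvd_triv_left)
    next
      case False
      then have 2: "2 \<le> card S" using insert by simp
      let ?C = "\<rho> ` supported (insert x S)"
      have C: "subgroup ?C (sym_group n)" by (rule image_subgroup[OF supported_subgroup supported_subset])
      have "{f \<in> ?C. f x = x} = \<rho> ` {a \<in> supported (insert x S). \<rho> a x = x}" by auto
      then have "{f \<in> ?C. f x = x} = \<rho> ` supported S"
        using supported_stabilizer[OF insert.hyps(2)] by simp
      moreover have "perm_orbit ?C x = insert x S"
        using supported_orbit[of "insert x S" x] insert 2 by simp
      ultimately have "card ?C = Suc (card S) * card (\<rho> ` supported S)"
        using card_eq_orbit_mult_stabilizer(2)[OF C, of x] insert.hyps by simp
      moreover have "Suc (card S) * fact (card S) dvd Suc (card S) * (2 * card (\<rho> ` supported S))"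
        using insert 2 by (intro mult_dvd_mono) auto
      ultimately show ?thesis using insert.hyps by (simp add: mult_ac)
    qed
  qed simp
qed

text \<open>
  A vertex \<open>B\<close> need be neither contained in \<open>N\<close> nor contain the kernel of \<open>\<rho>\<close>; its trace is a
  finite permutation group in either case.
\<close>

definition trace :: "'a set \<Rightarrow> (nat \<Rightarrow> nat) set" where
  "trace B = \<rho> ` (B \<inter> N)"

lemma trace_subgroup: "subgroup B G \<Longrightarrow> subgroup (trace B) (sym_group n)"
  unfolding trace_def by (intro image_subgroup subgroups_Inter_pair N_subgroup) auto

lemma good_supported:
  assumes S: "S \<subseteq> {1..n}" "card S = q"
  shows "good (trace (supported S)) S"
proof -
  have tr: "trace (supported S) = \<rho> ` supported S"
    using supported_subset by (simp add: trace_def Int_absorb2)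
  have "S \<noteq> {}" using S q_gt by auto
  then obtain x where "x \<in> S" by auto
  then have "perm_orbit (trace (supported S)) x = S"
    using supported_orbit[of S x] S q_gt tr by simp
  then have "big_orbit (trace (supported S)) S" using S by (auto simp: big_orbit_def)
  moreover have "fact q dvd 2 * p ^ 0 * card (trace (supported S))"
    using fact_dvd_card_image_supported[of S] S q_gt tr by simp
  ultimately show ?thesis
    using trace_subgroup[OF supported_subgroup] unfolding good_def by blast
qed

text \<open>
  Neither the intersection with the normal subgroup \<open>N\<close> nor the image under \<open>\<rho>\<close> introduces new
  prime factors into an index.
\<close>

lemma card_trace:
  assumes B: "subgroup B G" and D: "subgroup D G" "D \<subseteq> B" and idx: "index_in G B D dvd p ^ j"
  shows "\<exists>a. card (trace B) = p ^ a * card (trace D)"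
proof -
  have BN: "subgroup (B \<inter> N) G" "subgroup (D \<inter> N) G"
    using subgroups_Inter_pair N_subgroup B D by blast+
  interpret S: group "sym_group n" by (rule sym_group_is_group)
  have "index_in (sym_group n) (trace B) (trace D) dvd index_in G (B \<inter> N) (D \<inter> N)"
    unfolding trace_def using D(2)
    by (intro index_in_hom_image_dvd BN S.group_axioms hom_restrict) auto
  also have "\<dots> dvd index_in G B D" by (rule index_in_Int_normal_dvd[OF N_normal B D])
  also note idx
  finally obtain a where "index_in (sym_group n) (trace B) (trace D) = p ^ a"
    using divides_primepow_nat[OF prime] by blast
  moreover have "trace D \<subseteq> trace B" using D(2) by (auto simp: trace_def)
  ultimately show ?thesis
    using S.card_subgroup_eq_index_mult[OF trace_subgroup[OF B] trace_subgroup[OF D(1)]] by metis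
qed

lemma edge_iff:
  "(A, B) \<in> parcs (local_commens_graph G p) \<longleftrightarrow> finite_index G A \<and> finite_index G B \<and> A \<noteq> B \<and>
     (\<exists>j. index_in G A (A \<inter> B) * index_in G B (A \<inter> B) = p ^ j)"
  by (auto simp: local_commens_graph_def)

lemma edge_good:
  assumes e: "(A, B) \<in> parcs (local_commens_graph G p)" and A: "good (trace A) U"
  shows "\<exists>V. good (trace B) V \<and> card (U - V) \<le> 1"
proof -
  obtain j where j: "index_in G A (A \<inter> B) * index_in G B (A \<inter> B) = p ^ j"
    and sub: "subgroup A G" "subgroup B G"
    using e by (auto simp: edge_iff finite_index_def)
  have D: "subgroup (A \<inter> B) G" using subgroups_Inter_pair sub by blast
  obtain a b where "card (trace A) = p ^ a * card (trace (A \<inter> B))"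
    "card (trace B) = p ^ b * card (trace (A \<inter> B))"
    using card_trace[OF sub(1) D, of j] card_trace[OF sub(2) D, of j] j by (metis Int_lower1 Int_lower2 dvd_triv_left dvd_triv_right)
  moreover have "trace (A \<inter> B) \<subseteq> trace A" "trace (A \<inter> B) \<subseteq> trace B" by (auto simp: trace_def)
  ultimately show ?thesis
    using good_step[OF A trace_subgroup[OF sub(2)] trace_subgroup[OF D]] by blast
qed

lemma walk_good:
  assumes "set es \<subseteq> parcs (local_commens_graph G p)" "pre_digraph.cas \<Gamma> A es B" "good (trace A) U"
  shows "\<exists>V. good (trace B) V \<and> card (U - V) \<le> length es"
  using assms
proof (induction es arbitrary: A U)
  case Nil
  then show ?case by (auto simp: pre_digraph.cas.simps intro!: exI[of _ U])
next
  case (Cons e es)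
  then have e: "e = (A, snd e)" "e \<in> parcs (local_commens_graph G p)" "pre_digraph.cas \<Gamma> (snd e) es B"
    by (auto simp: pre_digraph.cas.simps)
  obtain V where V: "good (trace (snd e)) V" "card (U - V) \<le> 1"
    using edge_good[of A "snd e" U] e Cons.prems(3) by metis
  obtain W where W: "good (trace B) W" "card (V - W) \<le> length es"
    using Cons.IH[OF _ e(3) V(1)] Cons.prems(1) by auto
  have "finite U" "finite V"
    using Cons.prems(3) V(1) finite_big_orbit by (auto simp: good_def)
  then have "card (U - W) \<le> card ((U - V) \<union> (V - W))" by (intro card_mono) auto
  also have "\<dots> \<le> card (U - V) + card (V - W)" by (rule card_Un_le)
  finally show ?case using V W by (intro exI[of _ W]) auto
qed

lemma length_walk_supported:
  assumes S: "S \<subseteq> {1..n}" "card S = q" and T: "T \<subseteq> {1..n}" "card T = q"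
    and es: "pre_digraph.apath \<Gamma> (supported S) es (supported T)"
  shows "card (S - T) \<le> length es"
proof -
  have "set es \<subseteq> parcs (local_commens_graph G p)" "pre_digraph.cas \<Gamma> (supported S) es (supported T)"
    using es by (auto simp: pre_digraph.apath_def pre_digraph.awalk_def)
  then obtain V where "good (trace (supported T)) V" "card (S - V) \<le> length es"
    using walk_good good_supported[OF S] by blast
  then show ?thesis using good_unique good_supported[OF T] by blast
qed

lemma edge_supported:
  assumes S: "insert x S \<subseteq> {1..n}" "x \<notin> S" "card S = q - 1"
  shows "(supported (insert x S), supported S) \<in> parcs (local_commens_graph G p)"
    and "(supported S, supported (insert x S)) \<in> parcs (local_commens_graph G p)"
proof -
  have sub: "supported S \<subseteq> supported (insert x S)" by (rule supported_mono) auto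
  have idx: "index_in G (supported (insert x S)) (supported S) = q"
    using index_supported[OF S(1,2)] S(3) q_gt by simp
  have self: "index_in G (supported S) (supported S) = 1"
  proof -
    have "index_in G (supported S) (supported S) = card ((\<lambda>a. 0 :: nat) ` supported S)"
      by (rule index_in_eq_card_image(1)[OF supported_subgroup subgroup.subset[OF supported_subgroup]])
        (simp add: subgroup.m_closed[OF supported_subgroup] subgroup.m_inv_closed[OF supported_subgroup])
    moreover have "(\<lambda>a. 0 :: nat) ` supported S = {0}" using subgroup.one_closed[OF supported_subgroup] by blast
    ultimately show ?thesis by simp
  qed
  have "supported (insert x S) \<noteq> supported S" using idx self q_gt by auto
  moreover have "index_in G (supported (insert x S)) (supported S) * index_in G (supported S) (supported S) = p ^ k"
    using idx self q_def by simp
  ultimately show "(supported (insert x S), supported S) \<in> parcs (local_commens_graph G p)"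
    "(supported S, supported (insert x S)) \<in> parcs (local_commens_graph G p)"
    using sub finite_index_supported by (auto simp: edge_iff Int_absorb1 Int_absorb2 mult.commute)
qed

lemma reachable_shifted_interval:
  "i \<le> c \<Longrightarrow> supported {1..q} \<rightarrow>\<^sup>*\<^bsub>\<Gamma>\<^esub> supported {i + 1..i + q}"
proof (induction i)
  interpret D: pair_bidirected_digraph "local_commens_graph G p"
    by (rule pair_bidirected_digraph_local_commens_graph)
  case 0
  have "supported {1..q} \<in> verts \<Gamma>" using finite_index_supported by (simp add: local_commens_graph_def)
  then show ?case by simp
next
  interpret D: pair_bidirected_digraph "local_commens_graph G p"
    by (rule pair_bidirected_digraph_local_commens_graph)
  case (Suc i)
  let ?S = "{i + 2..i + q}"
  have ins: "insert (i + 1) ?S = {i + 1..i + q}" "insert (i + q + 1) ?S = {Suc i + 1..Suc i + q}"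
    using q_gt by auto
  have "{i + 1..i + q} \<subseteq> {1..n}" "{Suc i + 1..Suc i + q} \<subseteq> {1..n}"
    using Suc.prems n_def by auto
  then have e: "(supported {i + 1..i + q}, supported ?S) \<in> parcs (local_commens_graph G p)"
    "(supported ?S, supported {Suc i + 1..Suc i + q}) \<in> parcs (local_commens_graph G p)"
    using edge_supported(1)[of "i + 1" ?S] edge_supported(2)[of "i + q + 1" ?S]
    unfolding ins by auto
  have "supported {1..q} \<rightarrow>\<^sup>*\<^bsub>\<Gamma>\<^esub> supported {i + 1..i + q}" using Suc by simp
  then show ?case by (rule D.reachable_adj_trans[OF D.reachable_adj_trans[OF _ e(1)] e(2)])
qed

text \<open>
  Start and end of the geodesic are the supports \<open>{1..q}\<close> and \<open>{c + 1..c + q}\<close>, which differ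
  in \<open>c\<close> points; the index divisibility separates components for different \<open>q\<close>.
\<close>

lemma long_geodesic:
  "\<exists>A \<gamma> B. geodesic \<Gamma> A \<gamma> B \<and> c \<le> length \<gamma> \<and> finite_index G A \<and>
     q + 1 dvd index_in G (carrier G) A"
proof -
  interpret D: pair_bidirected_digraph "local_commens_graph G p"
    by (rule pair_bidirected_digraph_local_commens_graph)
  let ?A = "supported {1..q}" and ?B = "supported {c + 1..c + q}"
  have "\<exists>es. pre_digraph.apath \<Gamma> ?A es ?B"
    using reachable_shifted_interval[of c] D.reachable_apath by auto
  then have "\<exists>l es. pre_digraph.apath \<Gamma> ?A es ?B \<and> length es = l" by blast
  then have "\<exists>es. pre_digraph.apath \<Gamma> ?A es ?B \<and> length es = graph_distance \<Gamma> ?A ?B"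
    unfolding graph_distance_def by (rule LeastI_ex)
  then obtain es where es: "pre_digraph.apath \<Gamma> ?A es ?B" "geodesic \<Gamma> ?A es ?B"
    by (auto simp: geodesic_def)
  have "{1..q} - {c + 1..c + q} = {1..c}" using q_gt by auto
  then have "c \<le> length es"
    using length_walk_supported[OF _ _ _ _ es(1)] n_def by simp
  moreover have "q + 1 dvd index_in G (carrier G) ?A"
  proof -
    have "insert (q + 1) {1..q} \<subseteq> {1..n}" using n_def c_pos by auto
    then have "index_in G (supported (insert (q + 1) {1..q})) ?A = q + 1"
      using index_supported[of "q + 1" "{1..q}"] q_gt by simp
    moreover have "?A \<subseteq> supported (insert (q + 1) {1..q})" by (rule supported_mono) auto
    ultimately show ?thesis
      using index_in_tower(1)[OF subgroup_self supported_subgroup supported_subgroup]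
        subgroup.subset[OF supported_subgroup] by (metis dvd_triv_right)
  qed
  ultimately show ?thesis using es(2) finite_index_supported by blast
qed

end

section \<open>Separating components\<close>

context group
begin

text \<open>
  Along an edge from \<open>A\<close> to \<open>C\<close>, both factors by which the index of \<open>A \<inter> C\<close> exceeds those of \<open>A\<close>
  and \<open>C\<close> are powers of \<open>p\<close>.
\<close>

lemma component_index:
  assumes "A \<rightarrow>\<^sup>*\<^bsub>with_proj (local_commens_graph G p)\<^esub> B"
  shows "\<exists>a. index_in G (carrier G) A dvd p ^ a * index_in G (carrier G) B"
proof -
  interpret D: pair_bidirected_digraph "local_commens_graph G p"
    by (rule pair_bidirected_digraph_local_commens_graph)
  obtain es where "pre_digraph.awalk (with_proj (local_commens_graph G p)) A es B"
    using assms D.reachable_awalk by auto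
  then have "set es \<subseteq> parcs (local_commens_graph G p)" "pcas A es B"
    by (auto simp: pre_digraph.awalk_def cas_with_proj_eq)
  then show ?thesis
  proof (induction es arbitrary: A)
    case Nil
    then show ?case by (auto intro!: exI[of _ 0])
  next
    case (Cons e es)
    define C where "C = snd e"
    have e: "(A, C) \<in> parcs (local_commens_graph G p)" "pcas C es B"
      using Cons.prems by (auto simp: C_def)
    obtain a where a: "index_in G (carrier G) C dvd p ^ a * index_in G (carrier G) B"
      using Cons.IH e Cons.prems by auto
    obtain j where j: "index_in G A (A \<inter> C) * index_in G C (A \<inter> C) = p ^ j"
      and sub: "subgroup A G" "subgroup C G"
      using e by (auto simp: local_commens_graph_def finite_index_def)
    let ?i = "\<lambda>X Y. index_in G X Y" let ?D = "A \<inter> C"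
    have D: "subgroup ?D G" using subgroups_Inter_pair sub by blast
    have "?i (carrier G) ?D = ?i (carrier G) A * ?i A ?D" "?i (carrier G) ?D = ?i (carrier G) C * ?i C ?D"
      using index_in_tower(1)[OF subgroup_self sub(1) D] index_in_tower(1)[OF subgroup_self sub(2) D]
        subgroup.subset[OF sub(1)] subgroup.subset[OF sub(2)] by auto
    then have "?i (carrier G) A dvd ?i (carrier G) C * ?i C ?D" by (metis dvd_triv_left)
    also have "\<dots> dvd (p ^ a * ?i (carrier G) B) * p ^ j"
      by (intro mult_dvd_mono a) (metis dvd_triv_right j)
    finally show ?case by (auto simp: power_add mult_ac intro!: exI[of _ "a + j"])
  qed
qed

end


text \<open>
  The normal core \<open>N\<close> is chosen before \<open>k\<close>, so its index is fixed while the number of permuted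
  points grows with \<open>k\<close>.
\<close>

lemma large_group_long_geodesics:
  fixes G :: "('a, 'b) monoid_scheme"
  assumes G: "large_group G" and p: "prime p"
  obtains k0 where "\<And>k. k0 \<le> k \<Longrightarrow>
    \<exists>A \<gamma> B. geodesic (with_proj (local_commens_graph G p)) A \<gamma> B \<and> L < length \<gamma> \<and>
      finite_index G A \<and> p ^ k + 1 dvd index_in G (carrier G) A"
proof -
  interpret group G using G by (simp add: large_group_def)
  obtain H h and F :: "'a monoid" where H: "finite_index G H" and F: "free_group F" "\<not> cyclic_group F"
    and h: "h \<in> epi (G\<lparr>carrier := H\<rparr>) F"
    using G unfolding large_group_def by blast
  obtain N where N: "N \<lhd> G" "finite_index G N" "N \<subseteq> H" using finite_index_normal_core[OF H] .
  have HG: "subgroup H G" and finN: "finite (rcosets\<^bsub>G\<^esub> N)"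
    using H N by (auto simp: finite_index_def)
  define c where "c = L + 1"
  (* as k < p ^ k, every bound that p ^ k has to exceed can be imposed on k *)
  define k0 where "k0 = (c + 1)\<^sup>2 + 4 * fact c + card (rcosets\<^bsub>G\<^esub> N) + 2"
  have "\<exists>A \<gamma> B. geodesic (with_proj (local_commens_graph G p)) A \<gamma> B \<and> L < length \<gamma> \<and>
      finite_index G A \<and> p ^ k + 1 dvd index_in G (carrier G) A" if k: "k0 \<le> k" for k
  proof -
    have "k < 2 ^ k" by (rule less_exp)
    also have "(2::nat) ^ k \<le> p ^ k" using prime_ge_2_nat[OF p] by (rule power_mono) simp
    finally have pk: "k0 < p ^ k" using k by simp
    interpret L: large_orbit p k c "p ^ k + c" "p ^ k"
      using p pk by unfold_locales (auto simp: c_def k0_def)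
    have n2: "2 \<le> p ^ k + c" using pk by (simp add: k0_def)
    obtain g where g: "g \<in> hom F (sym_group (p ^ k + c))"
      "g ` carrier F = carrier (sym_group (p ^ k + c))"
      using free_group_surj_sym_group[OF F n2] .
    have gh: "g \<circ> h \<in> hom (G\<lparr>carrier := H\<rparr>) (sym_group (p ^ k + c))"
    proof (rule Group.hom_compose)
      show "h \<in> hom (G\<lparr>carrier := H\<rparr>) F" using h by (simp add: epi_def)
    qed (rule g(1))
    have "h ` H = carrier F" using h by (simp add: epi_def)
    then have onto: "(g \<circ> h) ` H = carrier (sym_group (p ^ k + c))"
      using g(2) by (simp only: image_comp[symmetric])
    interpret R: permutation_representation G p k c "p ^ k + c" "p ^ k" N "g \<circ> h"
    proof (intro permutation_representation.intro permutation_representation_axioms.intro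
        group_axioms L.large_orbit_axioms N(1,2))
      show "g \<circ> h \<in> hom (G\<lparr>carrier := N\<rparr>) (sym_group (p ^ k + c))"
        using gh N(3) by (auto simp: hom_def)
      show "Transposition.transpose x y \<circ> Transposition.transpose x z \<in> (g \<circ> h) ` N"
        if "x \<in> {1..p ^ k + c}" "y \<in> {1..p ^ k + c}" "z \<in> {1..p ^ k + c}"
          "x \<noteq> y" "x \<noteq> z" "y \<noteq> z" for x y z
        using that pk
        by (intro three_cycles_in_image_of_normal[OF HG N(1,3) finN _ gh onto]) (auto simp: k0_def)
    qed
    show ?thesis using R.long_geodesic by (auto simp: c_def Suc_le_eq)
  qed
  then show ?thesis using that by blast
qed

theorem corollary4:
  fixes G :: "('a, 'b) monoid_scheme" and p N :: nat
  assumes "large_group G" and "prime p" and "N > 0"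
  shows "\<exists>\<Gamma> :: ('a set \<times> ('a set \<times> 'a set) list \<times> 'a set) set.
    infinite \<Gamma> \<and>
    (\<forall>(A, \<gamma>, B) \<in> \<Gamma>. geodesic (with_proj (local_commens_graph G p)) A \<gamma> B \<and> length \<gamma> > N) \<and>
    inj_on (\<lambda>(A, \<gamma>, B). pre_digraph.scc_of (with_proj (local_commens_graph G p)) A) \<Gamma>"
proof -
  interpret group G using assms(1) by (simp add: large_group_def)
  interpret D: pair_bidirected_digraph "local_commens_graph G p"
    by (rule pair_bidirected_digraph_local_commens_graph)
  let ?D = "with_proj (local_commens_graph G p)"
  let ?comp = "\<lambda>(A, \<gamma> :: ('a set \<times> 'a set) list, B :: 'a set). pre_digraph.scc_of ?D A"
  obtain k0 where k0: "\<And>k. k0 \<le> k \<Longrightarrow> \<exists>A \<gamma> B. geodesic ?D A \<gamma> B \<and> N < length \<gamma> \<and>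
      finite_index G A \<and> p ^ k + 1 dvd index_in G (carrier G) A"
    using large_group_long_geodesics[OF assms(1,2), where L = N] by blast
  then obtain A \<gamma> B where geo: "\<And>k. k0 \<le> k \<Longrightarrow> geodesic ?D (A k) (\<gamma> k) (B k) \<and> N < length (\<gamma> k) \<and>
      finite_index G (A k) \<and> p ^ k + 1 dvd index_in G (carrier G) (A k)"
    by metis
  define t where "t k = (A k, \<gamma> k, B k)" for k
  (* a component containing infinitely many of the A k would contain a vertex whose index
     is divisible by p ^ k + 1 for infinitely many k *)
  have "infinite ((?comp \<circ> t) ` {k0..})"
  proof
    assume "finite ((?comp \<circ> t) ` {k0..})"
    moreover have "infinite {k0..}" by (rule infinite_Ici)
    ultimately have "\<exists>m\<in>{k0..}. infinite {k \<in> {k0..}. (?comp \<circ> t) k = (?comp \<circ> t) m}"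
      by (intro pigeonhole_infinite)
    then obtain m where m: "m \<in> {k0..}"
      and inf: "infinite {k \<in> {k0..}. (?comp \<circ> t) k = (?comp \<circ> t) m}" ..
    let ?i = "index_in G (carrier G) (A m)"
    have "k0 \<le> m" using m by simp
    note gm = geo[OF this]
    then have pos: "?i > 0" using index_in_carrier_pos by blast
    have "k \<le> ?i" if k: "k0 \<le> k" "(?comp \<circ> t) k = (?comp \<circ> t) m" for k
    proof -
      have "A m \<in> verts ?D" using gm by (simp add: local_commens_graph_def)
      then have "A m \<in> pre_digraph.scc_of ?D (A m)" using D.in_scc_of_self by simp
      then have "A m \<in> pre_digraph.scc_of ?D (A k)" using k(2) by (simp add: t_def)
      then have "A k \<rightarrow>\<^sup>*\<^bsub>?D\<^esub> A m" by (simp add: pre_digraph.scc_of_def)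
      then obtain a where "index_in G (carrier G) (A k) dvd p ^ a * ?i" using component_index by blast
      then have "p ^ k + 1 dvd p ^ a * ?i" using geo[OF k(1)] dvd_trans by blast
      moreover have "coprime (p ^ k + 1) (p ^ a)" if "k > 0"
      proof -
        have "coprime (p ^ k + 1) (p ^ k)" by (rule coprime_add_one_left)
        then show ?thesis using that unfolding coprime_power_right_iff by blast
      qed
      ultimately have "p ^ k + 1 \<le> ?i \<or> k = 0"
        using pos coprime_dvd_mult_right_iff dvd_imp_le by blast
      moreover have "k < 2 ^ k" "(2::nat) ^ k \<le> p ^ k"
        using prime_ge_2_nat[OF assms(2)] by (auto intro: power_mono less_exp)
      ultimately show ?thesis by linarith
    qed
    then have "{k \<in> {k0..}. (?comp \<circ> t) k = (?comp \<circ> t) m} \<subseteq> {..?i}" by auto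
    then show False using inf finite_subset by blast
  qed
  moreover obtain I where I: "I \<subseteq> {k0..}" "inj_on (?comp \<circ> t) I"
    "(?comp \<circ> t) ` {k0..} = (?comp \<circ> t) ` I"
    using subset_image_inj[of "(?comp \<circ> t) ` {k0..}" "?comp \<circ> t" "{k0..}"] by auto
  ultimately have "infinite (?comp ` t ` I)" unfolding image_comp by argo
  then have "infinite (t ` I)" by (rule contrapos_nn) (rule finite_imageI)
  moreover have "inj_on ?comp (t ` I)" using I(2) by (rule inj_on_imageI)
  moreover have "\<forall>(A, \<gamma>, B) \<in> t ` I. geodesic ?D A \<gamma> B \<and> length \<gamma> > N"
    using geo I(1) by (auto simp: t_def)
  ultimately show ?thesis by blast
qed

end
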